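(* Let $n\ge1$, let $\mathfrak p_0\in A=\mathbb F_q[T]$ be monic irreducible of degree $r$ with $\gcd(n,r)=1$, let $t\in\mathbb F_{q^r}$ be a root of $\mathfrak p_0$, let $\phi$ be the Drinfeld module with $\phi_T=t+\tau^n$, and let $m\mid n$. Suppose $\mathfrak p_0-1$ is irreducible and take $\mathfrak p=\mathfrak p_0-1$, so that $M=\phi[\mathfrak p]=\mathbb F_{q^{nr}}$. Let $R_{\mathrm{MP}}$ denote the ring of $q^r$-linearized polynomials over $\mathbb F_{q^m}$ modulo $x^{[rn]}-x$, acting on $\mathbb F_{q^{rn}}$ by evaluation. Then the subring of $R$ generated by $L$ and $\pi$ coincides with $R_{\mathrm{MP}}$ as a ring of operators on $M$, and multiplication $\kappa\otimes_{\mathbb F_q}R_{\mathrm{MP}}\to R$ is an isomorphism of rings. In particular, $R=R_{\mathrm{MP}}$ if and only if $r=1$, in which case the left ideals of $R$ (the skew cyclic codes at the prime $\mathfrak p=\mathfrak p_0-1$ with parameter $m$) are exactly the left ideals of $R_{\mathrm{MP}}$, with $S$-normal elements corresponding to normal bases of $\mathbb F_{q^n}/\mathbb F_q$ (i.e. $\alpha\in M=\mathbb F_{q^n}$ is $S$-normal if and only if $\alpha,\alpha^{[1]},\dots,\alpha^{[n-1]}$ is an $\mathbb F_q$-basis of $\mathbb F_{q^n}$).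
   Context: $q$ is a prime power, $A=\mathbb F_q[T]$, $\overline{\mathbb F}_q$ a fixed algebraic closure, $[i]=q^i$, $\beta^{[i]}=\beta^{q^i}$, $x^{[i]}=x^{q^i}$. Twisted polynomials in $\tau$ satisfy $\tau a=a^q\tau$ and act on $\overline{\mathbb F}_q$ with $\tau$ acting as $x\mapsto x^q$ and constants by multiplication. $\phi\colon A\to\mathbb F_{q^r}\{\tau\}$, $a\mapsto\phi_a$, is the $\mathbb F_q$-algebra homomorphism with $\phi_T=t+\tau^n$. Put $\kappa=A/\mathfrak p$ and $M=\phi[\mathfrak p]=\{v\in\overline{\mathbb F}_q:\phi_{\mathfrak p}(v)=0\}$, a $\kappa$-vector space of dimension $n$ via $a\cdot v=\phi_a(v)$ (for $\mathfrak p=\mathfrak p_0-1$ one has $\phi_{\mathfrak p}=\tau^{nr}-1$, $\deg\mathfrak p=r$, and $\kappa$ acts through $\phi$, not in general by field scalars); $E=\operatorname{End}_\kappa(M)$; $\pi=\tau^r$, acting on $M$ by $v\mapsto v^{[r]}$; $S=\kappa[\pi|_M]$; $R_0=\kappa[\pi^m|_M]$; $R=\operatorname{Cent}_E(R_0)$ (centralizer); $L=\mathbb F_{q^m}\subseteq R$ acting on $M$ by scalar multiplication. $\kappa$ is identified with the $\kappa$-scalars in $E$, which lie in $R$. An element $\alpha\in M$ is $S$-normal if $\alpha,\alpha^{[r]},\dots,\alpha^{[r(n-1)]}$ is a $\kappa$-basis of $M$. $R_{\mathrm{MP}}$: $q^r$-linearized polynomials over $\mathbb F_{q^m}$ are the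 polynomials $\sum_iF_ix^{[ri]}$ with $F_i\in\mathbb F_{q^m}$, a ring under addition and composition; $R_{\mathrm{MP}}$ is its quotient by the two-sided ideal generated by $x^{[rn]}-x$ (central as $m\mid n$). The class of $\sum_iF_ix^{[ri]}$ acts on $\mathbb F_{q^{rn}}$ by $v\mapsto\sum_iF_iv^{[ri]}$. The left ideals of $R_{\mathrm{MP}}$ are the skew cyclic ($q^r$-cyclic) codes of Martínez-Peñas. *)

theory Defs
  imports "HOL-Algebra.Algebraic_Closure_Type" "HOL-Algebra.Generated_Rings"
    "HOL-Library.Cardinality" "HOL-Library.Poly_Mapping"
begin

section \<open>Finite fields inside a fixed algebraic closure\<close>

text \<open>
  The base field \<open>\<F>\<^sub>q\<close> is an arbitrary finite field type \<open>'f\<close>, so that \<open>q = CARD('f)\<close>, the ring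
  \<open>A = \<F>\<^sub>q[T]\<close> is \<open>'f poly\<close>, and the algebraic closure is the library type \<open>'f alg_closure\<close>, into
  which \<open>'f\<close> is embedded by \<^const>\<open>to_ac\<close>. A subset or subfield named \<open>\<F>\<^bsub>q^k\<^esub>\<close> is always taken
  inside this closure.
\<close>

definition frob :: "nat \<Rightarrow> 'f::{field,finite} alg_closure \<Rightarrow> 'f alg_closure" where
  "frob i x = x ^ (CARD('f) ^ i)"

definition GF :: "nat \<Rightarrow> 'f::{field,finite} alg_closure set" where
  "GF k = {x. frob k x = x}"

abbreviation A_ring :: "'f::{field,finite} poly ring" where
  "A_ring \<equiv> ring_of_type_algebra"

section \<open>Twisted polynomials and the Drinfeld module\<close>

text \<open>
  The twisted polynomial \<open>\<Sum>\<^sub>i a\<^sub>i \<tau>\<^sup>i\<close> is encoded by the polynomial with the same coefficients; only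
  the multiplication differs from the one of polynomials, by the rule \<open>\<tau> a = a\<^sup>q \<tau>\<close>.
\<close>

definition twisted_mult ::
    "'f::{field,finite} alg_closure poly \<Rightarrow> 'f alg_closure poly \<Rightarrow> 'f alg_closure poly" where
  "twisted_mult f g =
     (\<Sum>i\<le>degree f. \<Sum>j\<le>degree g. monom (coeff f i * frob i (coeff g j)) (i + j))"

definition twisted_ring :: "'f::{field,finite} alg_closure set \<Rightarrow> 'f alg_closure poly ring" where
  "twisted_ring K =
     \<lparr>carrier = {f. \<forall>i. coeff f i \<in> K}, monoid.mult = twisted_mult,
      one = 1, ring.zero = 0, add = (+)\<rparr>"

definition twisted_apply ::
    "'f::{field,finite} alg_closure poly \<Rightarrow> 'f alg_closure \<Rightarrow> 'f alg_closure" where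
  "twisted_apply f v = (\<Sum>i\<le>degree f. coeff f i * frob i v)"

definition twisted_algebra_hom ::
    "nat \<Rightarrow> ('f::{field,finite} poly \<Rightarrow> 'f alg_closure poly) \<Rightarrow> bool" where
  "twisted_algebra_hom r \<phi> \<longleftrightarrow>
     \<phi> \<in> ring_hom A_ring (twisted_ring (GF r)) \<and> (\<forall>c. \<phi> [:c:] = [:to_ac c:])"

definition residue_field :: "'f::{field,finite} poly \<Rightarrow> 'f poly set ring" where
  "residue_field p = A_ring Quot (PIdl\<^bsub>A_ring\<^esub> p)"

text \<open>
  The \<open>\<kappa>\<close>-module \<open>\<phi>[\<pp>]\<close>. A residue class acts through any representative \<open>a\<close>; the value does not
  depend on \<open>a\<close>, and \<^const>\<open>the_elem\<close> extracts it. The ring multiplication and unit, which the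
  library's module records carry along, have no meaning here.
\<close>

definition torsion_module ::
    "('f::{field,finite} poly \<Rightarrow> 'f alg_closure poly) \<Rightarrow> 'f poly
      \<Rightarrow> ('f poly set, 'f alg_closure) module" where
  "torsion_module \<phi> p =
     \<lparr>carrier = {v. twisted_apply (\<phi> p) v = 0}, monoid.mult = undefined, one = undefined,
      ring.zero = 0, add = (+),
      module.smult = (\<lambda>C v. the_elem ((\<lambda>a. twisted_apply (\<phi> a) v) ` C))\<rparr>"

section \<open>Endomorphism rings, centralizers, left ideals, bases\<close>

text \<open>Endomorphisms are extensional functions, so that equality of operators is equality in HOL.\<close>

definition End_ring :: "('k, 'x) ring_scheme \<Rightarrow> ('k, 'v, 'y) module_scheme \<Rightarrow> ('v \<Rightarrow> 'v) ring" where
  "End_ring K M =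
     \<lparr>carrier = {f \<in> carrier M \<rightarrow>\<^sub>E carrier M.
         (\<forall>v\<in>carrier M. \<forall>w\<in>carrier M. f (v \<oplus>\<^bsub>M\<^esub> w) = f v \<oplus>\<^bsub>M\<^esub> f w) \<and>
         (\<forall>a\<in>carrier K. \<forall>v\<in>carrier M. f (a \<odot>\<^bsub>M\<^esub> v) = a \<odot>\<^bsub>M\<^esub> f v)},
      monoid.mult = compose (carrier M),
      one = (\<lambda>v\<in>carrier M. v),
      ring.zero = (\<lambda>v\<in>carrier M. \<zero>\<^bsub>M\<^esub>),
      add = (\<lambda>f g. \<lambda>v\<in>carrier M. f v \<oplus>\<^bsub>M\<^esub> g v)\<rparr>"

definition scalar_op :: "('k, 'v, 'y) module_scheme \<Rightarrow> 'k \<Rightarrow> 'v \<Rightarrow> 'v" where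
  "scalar_op M a = (\<lambda>v\<in>carrier M. a \<odot>\<^bsub>M\<^esub> v)"

definition centralizer_ring :: "'a ring \<Rightarrow> 'a set \<Rightarrow> 'a ring" where
  "centralizer_ring E Z =
     E\<lparr>carrier := {f \<in> carrier E. \<forall>g\<in>Z. f \<otimes>\<^bsub>E\<^esub> g = g \<otimes>\<^bsub>E\<^esub> f}\<rparr>"

definition left_ideal :: "'a set \<Rightarrow> ('a, 'b) ring_scheme \<Rightarrow> bool" where
  "left_ideal I R \<longleftrightarrow>
     additive_subgroup I R \<and> (\<forall>a\<in>carrier R. \<forall>x\<in>I. a \<otimes>\<^bsub>R\<^esub> x \<in> I)"

definition basis_family ::
    "('k, 'x) ring_scheme \<Rightarrow> ('k, 'v, 'y) module_scheme \<Rightarrow> nat \<Rightarrow> (nat \<Rightarrow> 'v) \<Rightarrow> bool" where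
  "basis_family K M n b \<longleftrightarrow>
     b \<in> {..<n} \<rightarrow> carrier M \<and>
     (\<forall>c\<in>{..<n} \<rightarrow> carrier K.
        (\<Oplus>\<^bsub>M\<^esub>i\<in>{..<n}. c i \<odot>\<^bsub>M\<^esub> b i) = \<zero>\<^bsub>M\<^esub> \<longrightarrow> (\<forall>i<n. c i = \<zero>\<^bsub>K\<^esub>)) \<and>
     (\<forall>v\<in>carrier M. \<exists>c\<in>{..<n} \<rightarrow> carrier K. v = (\<Oplus>\<^bsub>M\<^esub>i\<in>{..<n}. c i \<odot>\<^bsub>M\<^esub> b i))"

section \<open>Operators on \<open>M = \<phi>[\<pp>]\<close>\<close>

definition frob_op :: "'f::{field,finite} alg_closure set \<Rightarrow> nat \<Rightarrow> 'f alg_closure \<Rightarrow> 'f alg_closure" where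
  "frob_op V i = (\<lambda>v\<in>V. frob i v)"

definition field_scalar_ops ::
    "'f::{field,finite} alg_closure set \<Rightarrow> nat \<Rightarrow> ('f alg_closure \<Rightarrow> 'f alg_closure) set" where
  "field_scalar_ops V m = {(\<lambda>v\<in>V. c * v) | c. c \<in> GF m}"

text \<open>\<open>R = Cent\<^sub>E(R\<^sub>0)\<close> with \<open>R\<^sub>0 = \<kappa>[\<pi>\<^sup>m]\<close> and \<open>\<pi> = \<tau>\<^sup>r\<close>, for a \<open>\<kappa>\<close>-module \<open>M\<close>.\<close>

definition skew_code_ring ::
    "('k, 'x) ring_scheme \<Rightarrow> ('k, 'f::{field,finite} alg_closure, 'y) module_scheme \<Rightarrow> nat \<Rightarrow> nat
      \<Rightarrow> ('f alg_closure \<Rightarrow> 'f alg_closure) ring" where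
  "skew_code_ring K M r m =
     (let E = End_ring K M; \<pi> = frob_op (carrier M) r;
          R\<^sub>0 = generate_ring E (scalar_op M ` carrier K \<union> {\<pi> [^]\<^bsub>E\<^esub> m})
      in centralizer_ring E R\<^sub>0)"

definition S_normal ::
    "('k, 'x) ring_scheme \<Rightarrow> ('k, 'f::{field,finite} alg_closure, 'y) module_scheme \<Rightarrow> nat \<Rightarrow> nat
      \<Rightarrow> 'f alg_closure \<Rightarrow> bool" where
  "S_normal K M r n \<alpha> \<longleftrightarrow> basis_family K M n (\<lambda>i. frob (r * i) \<alpha>)"

definition GF_module :: "nat \<Rightarrow> ('f::{field,finite}, 'f alg_closure) module" where
  "GF_module k =
     \<lparr>carrier = GF k, monoid.mult = (*), one = 1, ring.zero = 0, add = (+),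
      module.smult = (\<lambda>c v. to_ac c * v)\<rparr>"

section \<open>The ring of linearized polynomials of Martinez-Penas\<close>

definition linearized_ring :: "nat \<Rightarrow> nat \<Rightarrow> 'f::{field,finite} alg_closure poly ring" where
  "linearized_ring r m =
     \<lparr>carrier = {\<Sum>i\<le>N. monom (F i) (CARD('f) ^ (r * i)) | F N. \<forall>i. F i \<in> GF m},
      monoid.mult = pcompose, one = [:0, 1:], ring.zero = 0, add = (+)\<rparr>"

definition MP_ideal :: "nat \<Rightarrow> nat \<Rightarrow> nat \<Rightarrow> 'f::{field,finite} alg_closure poly set" where
  "MP_ideal r m n =
     Idl\<^bsub>linearized_ring r m\<^esub> {monom 1 (CARD('f) ^ (r * n)) - monom 1 1}"

definition MP_ring :: "nat \<Rightarrow> nat \<Rightarrow> nat \<Rightarrow> 'f::{field,finite} alg_closure poly set ring" where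
  "MP_ring r m n = linearized_ring r m Quot MP_ideal r m n"

text \<open>Evaluation of a class on \<open>V\<close>, through any representative.\<close>

definition MP_op ::
    "'f::{field,finite} alg_closure set \<Rightarrow> 'f alg_closure poly set \<Rightarrow> 'f alg_closure \<Rightarrow> 'f alg_closure" where
  "MP_op V C = the_elem ((\<lambda>F. restrict (poly F) V) ` C)"

section \<open>Tensor products of algebras\<close>

text \<open>
  For algebras \<open>A\<close>, \<open>B\<close> over a commutative ring \<open>k\<close> (a type), given by structure maps \<open>\<iota>\<close>, \<open>\<iota>'\<close> into
  the centres, the ring \<open>A \<otimes>\<^sub>k B\<close> is \<open>\<int>[A \<times> B]\<close>, the monoid ring of the multiplicative monoid
  \<open>A \<times> B\<close>, modulo the relations of biadditivity and \<open>k\<close>-balancedness. Multiplying one of these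
  relations by a generator of \<open>\<int>[A \<times> B]\<close> gives another one, so the ideal they generate is just
  the additive subgroup they generate, and the additive group is the usual tensor product.
\<close>

definition monoid_ring :: "('a, 'b) monoid_scheme \<Rightarrow> ('a \<Rightarrow>\<^sub>0 int) ring" where
  "monoid_ring G =
     \<lparr>carrier = {x. Poly_Mapping.keys x \<subseteq> carrier G},
      monoid.mult = (\<lambda>x y. frag_extend (\<lambda>a. frag_extend (\<lambda>b. frag_of (a \<otimes>\<^bsub>G\<^esub> b)) y) x),
      one = frag_of \<one>\<^bsub>G\<^esub>, ring.zero = 0, add = (+)\<rparr>"

definition tensor_relations ::
    "('k \<Rightarrow> 'a) \<Rightarrow> ('k \<Rightarrow> 'b) \<Rightarrow> 'a ring \<Rightarrow> 'b ring \<Rightarrow> ('a \<times> 'b \<Rightarrow>\<^sub>0 int) set" where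
  "tensor_relations \<iota> \<iota>' A B =
     {frag_of (a \<oplus>\<^bsub>A\<^esub> a', b) - frag_of (a, b) - frag_of (a', b) | a a' b.
        a \<in> carrier A \<and> a' \<in> carrier A \<and> b \<in> carrier B} \<union>
     {frag_of (a, b \<oplus>\<^bsub>B\<^esub> b') - frag_of (a, b) - frag_of (a, b') | a b b'.
        a \<in> carrier A \<and> b \<in> carrier B \<and> b' \<in> carrier B} \<union>
     {frag_of (a \<otimes>\<^bsub>A\<^esub> \<iota> c, b) - frag_of (a, \<iota>' c \<otimes>\<^bsub>B\<^esub> b) | a b c.
        a \<in> carrier A \<and> b \<in> carrier B}"

definition tensor_ideal ::
    "('k \<Rightarrow> 'a) \<Rightarrow> ('k \<Rightarrow> 'b) \<Rightarrow> 'a ring \<Rightarrow> 'b ring \<Rightarrow> ('a \<times> 'b \<Rightarrow>\<^sub>0 int) set" where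
  "tensor_ideal \<iota> \<iota>' A B = Idl\<^bsub>monoid_ring (A \<times>\<times> B)\<^esub> (tensor_relations \<iota> \<iota>' A B)"

definition tensor_ring ::
    "('k \<Rightarrow> 'a) \<Rightarrow> ('k \<Rightarrow> 'b) \<Rightarrow> 'a ring \<Rightarrow> 'b ring \<Rightarrow> ('a \<times> 'b \<Rightarrow>\<^sub>0 int) set ring" where
  "tensor_ring \<iota> \<iota>' A B = monoid_ring (A \<times>\<times> B) Quot tensor_ideal \<iota> \<iota>' A B"

definition pure_tensor ::
    "('k \<Rightarrow> 'a) \<Rightarrow> ('k \<Rightarrow> 'b) \<Rightarrow> 'a ring \<Rightarrow> 'b ring \<Rightarrow> 'a \<Rightarrow> 'b \<Rightarrow> ('a \<times> 'b \<Rightarrow>\<^sub>0 int) set" where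
  "pure_tensor \<iota> \<iota>' A B a b =
     tensor_ideal \<iota> \<iota>' A B +>\<^bsub>monoid_ring (A \<times>\<times> B)\<^esub> frag_of (a, b)"

text \<open>The \<open>\<F>\<^sub>q\<close>-algebra structures of \<open>\<kappa>\<close> and of the ring of Martinez-Penas (\<open>c \<mapsto> c x\<close>).\<close>

definition residue_const :: "'f::{field,finite} poly \<Rightarrow> 'f \<Rightarrow> 'f poly set" where
  "residue_const p c = PIdl\<^bsub>A_ring\<^esub> p +>\<^bsub>A_ring\<^esub> [:c:]"

definition MP_const ::
    "nat \<Rightarrow> nat \<Rightarrow> nat \<Rightarrow> 'f::{field,finite} \<Rightarrow> 'f alg_closure poly set" where
  "MP_const r m n c = MP_ideal r m n +>\<^bsub>linearized_ring r m\<^esub> [:0, to_ac c:]"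

end

theory Submission
  imports Defs "HOL-Number_Theory.Cong" "HOL-Algebra.Free_Abelian_Groups"
begin

text \<open>
  Write \<open>T = t + \<tau>\<^sup>n\<close> for the action of the variable on the algebraic closure and \<open>V = GF (n * r)\<close>.

  The module is \<open>V\<close>. Substitute \<open>T\<close> into a polynomial with coefficients in \<open>\<F>\<^bsub>q^r\<^esub>\<close> written on the
  left. By the commutation rule of \<open>\<tau>\<close>, the product of the first \<open>k\<close> factors \<open>X - t\<^bsup>[ni]\<^esup>\<close> goes to
  \<open>\<tau>\<^bsup>nk\<^esup>\<close> (\<open>eval_T_conj_prod\<close>). As \<open>n\<close> is coprime to \<open>r\<close>, the product of the first \<open>r\<close> factors is
  \<open>p0\<close> (\<open>irreducible_eq_conj_prod\<close>). So \<open>p0\<close> acts as \<open>\<tau>\<^bsup>nr\<^esup>\<close>, and \<open>p = p0 - 1\<close> has kernel \<open>V\<close>.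

  The ring \<open>R\<close> has coordinates. Every \<open>\<F>\<^sub>q\<close>-linear operator on \<open>V\<close> is a linearized polynomial, by
  interpolation (\<open>linearized_on_of_linear\<close>). By the Chinese remainder theorem the powers of \<open>\<tau>\<close> are
  combinations of the \<open>n r\<close> operators \<open>T\<^sup>i \<tau>\<^bsup>rj\<^esup>\<close> with \<open>i < r\<close> and \<open>j < n\<close>, and by counting these are
  linearly independent over \<open>V\<close> (\<open>comb_inj\<close>). For a coefficient \<open>c\<close>, commuting with \<open>\<pi>\<^sup>m = \<tau>\<^bsup>rm\<^esup>\<close>
  means \<open>c \<in> \<F>\<^bsub>q^(rm)\<^esub>\<close>, and commuting with \<open>T\<close> means \<open>c \<in> \<F>\<^bsub>q^n\<^esub>\<close> because
  \<open>T c - c T = (c\<^bsup>[n]\<^esup> - c) \<tau>\<^sup>n\<close>. Therefore \<open>R\<close> consists exactly of the sums \<open>\<Sum> c\<^sub>i\<^sub>j T\<^sup>i \<tau>\<^bsup>rj\<^esup>\<close> with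
  \<open>c\<^sub>i\<^sub>j \<in> \<F>\<^bsub>q^m\<^esub>\<close>, with unique coefficients (\<open>commutant_eq_comb\<close>, \<open>comb_R\<close>).

  The theorem can be read off. The row \<open>i = 0\<close> consists of the reduced linearized polynomials, so
  \<open>R\<^bsub>MP\<^esub>\<close> acts faithfully, and its image is generated by \<open>L\<close> and \<open>\<pi>\<close>. The powers \<open>T\<^sup>i\<close> with
  \<open>i < r\<close> are an \<open>\<F>\<^sub>q\<close>-basis of \<open>\<kappa>\<close>, so the unique expansion says that multiplication
  \<open>\<kappa> \<otimes> R\<^bsub>MP\<^esub> \<rightarrow> R\<close> is bijective (\<open>tensor_ring_iso_of_basis\<close>). The row \<open>i = 0\<close> is everything exactly
  when \<open>r = 1\<close>, and then \<open>\<kappa> = \<F>\<^sub>q\<close>.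
\<close>

section \<open>Frobenius powers and finite fields\<close>

lemma power_card_eq_self: "x ^ CARD('f) = x" for x :: "'f::{field,finite}"
proof (cases "x = 0")
  case True
  then show ?thesis by simp
next
  case False
  have bij: "bij_betw ((*) x) (UNIV - {0}) (UNIV - {0})"
    by (rule bij_betwI[of _ _ _ "\<lambda>y. y / x"]) (use False in auto)
  have "(\<Prod>y\<in>UNIV - {0}. y) = (\<Prod>y\<in>UNIV - {0}. x * y)"
    by (rule prod.reindex_bij_betw[OF bij, symmetric])
  also have "\<dots> = x ^ (CARD('f) - 1) * (\<Prod>y\<in>UNIV - {0::'f}. y)"
    by (simp add: prod.distrib card_Diff_subset)
  finally have "x ^ (CARD('f) - 1) = 1" by simp
  moreover have "CARD('f) = Suc (CARD('f) - 1)" by (simp add: card_gt_0_iff)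
  ultimately show ?thesis by (metis mult.right_neutral power_Suc)
qed

text \<open>
  The polynomial \<open>(X + 1)\<^sup>q - X\<^sup>q - 1\<close> has degree less than \<open>q\<close> and, by Fermat, vanishes at all \<open>q\<close>
  elements of the field; so it is zero, and its coefficients are the binomials below.
\<close>

lemma binomial_card_eq_0:
  assumes "0 < i" "i < CARD('f::{field,finite})"
  shows "(of_nat (CARD('f) choose i) :: 'f) = 0"
proof -
  define q where "q = CARD('f)"
  define P :: "'f poly" where "P = (\<Sum>k\<in>{1..<q}. monom (of_nat (q choose k)) k)"
  note fermat = power_card_eq_self[where 'f='f, folded q_def]
  have roots: "poly P x = 0" for x
  proof -
    have eq: "{0..q} = insert 0 (insert q {1..<q})" using assms q_def by auto
    have "(x + 1) ^ q = (\<Sum>k\<le>q. of_nat (q choose k) * x ^ k * 1 ^ (q - k))"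
      by (rule binomial_ring)
    also have "\<dots> = 1 + (x ^ q + poly P x)"
      using assms q_def unfolding atMost_atLeast0 eq by (simp add: P_def poly_sum poly_monom)
    finally show ?thesis by (simp add: fermat)
  qed
  have "P = 0"
  proof (rule ccontr)
    assume "P \<noteq> 0"
    from card_poly_roots_bound[OF this] have "q \<le> degree P" by (simp add: roots q_def)
    moreover have "degree P \<le> q - 1"
      unfolding P_def by (rule degree_sum_le) (auto intro!: order_trans[OF degree_monom_le])
    ultimately show False using assms q_def by simp
  qed
  then have "coeff P i = 0" by simp
  then show ?thesis using assms
    by (simp add: P_def coeff_sum q_def if_distrib cong: if_cong)
qed

lemma power_card_add:
  fixes x y :: "'a::comm_ring_1"
  assumes "\<And>i. 0 < i \<Longrightarrow> i < CARD('f::{field,finite}) \<Longrightarrow> of_nat (CARD('f) choose i) = (0::'a)"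
  shows "(x + y) ^ (CARD('f) ^ k) = x ^ (CARD('f) ^ k) + y ^ (CARD('f) ^ k)"
proof -
  define q where "q = CARD('f)"
  have q: "q > 0" by (simp add: q_def)
  have base: "(x + y) ^ q = x ^ q + y ^ q" for x y :: 'a
  proof -
    have eq: "{0..q} = insert 0 (insert q {1..<q})" using q by auto
    have "(x + y) ^ q = (\<Sum>k\<le>q. of_nat (q choose k) * x ^ k * y ^ (q - k))"
      by (rule binomial_ring)
    also have "\<dots> = y ^ q + x ^ q"
      using assms q unfolding atMost_atLeast0 eq by (simp add: q_def)
    finally show ?thesis by (simp add: add.commute)
  qed
  show ?thesis unfolding q_def[symmetric]
    by (induction k) (simp_all add: power_mult base mult.commute[of q])
qed

lemma binomial_card_eq_0_closure:
  assumes "0 < i" "i < CARD('f::{field,finite})"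
  shows "of_nat (CARD('f) choose i) = (0 :: 'f alg_closure)"
    and "of_nat (CARD('f) choose i) = (0 :: 'f alg_closure poly)"
proof -
  show *: "of_nat (CARD('f) choose i) = (0 :: 'f alg_closure)"
    using binomial_card_eq_0[OF assms] by (metis to_ac_0 to_ac_of_nat)
  show "of_nat (CARD('f) choose i) = (0 :: 'f alg_closure poly)"
    using * by (simp add: of_nat_poly)
qed

lemma card_gt_1: "CARD('f::{field,finite}) > 1"
proof -
  have "card {0::'f, 1} \<le> CARD('f)" by (rule card_mono) auto
  then show ?thesis by simp
qed

lemma frob_add: "frob i (x + y) = frob i x + frob i y"
  unfolding frob_def by (rule power_card_add) (rule binomial_card_eq_0_closure)

lemma frob_0 [simp]: "frob i 0 = 0"
  by (simp add: frob_def power_0_left)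

lemma frob_1 [simp]: "frob i 1 = 1"
  by (simp add: frob_def)

lemma frob_mult: "frob i (x * y) = frob i x * frob i y"
  by (simp add: frob_def power_mult_distrib)

lemma frob_zero_id [simp]: "frob 0 x = x"
  by (simp add: frob_def)

lemma frob_frob: "frob i (frob j x) = frob (i + j) x"
  by (simp add: frob_def power_add power_mult mult.commute flip: power_mult)

lemma frob_minus: "frob i (- x) = - frob i x"
  using frob_add[of i x "- x"] by (simp add: eq_neg_iff_add_eq_0 add.commute)

lemma frob_diff: "frob i (x - y) = frob i x - frob i y"
  using frob_add[of i x "- y"] by (simp add: frob_minus)

lemma frob_sum: "frob i (sum f A) = (\<Sum>a\<in>A. frob i (f a))"
  by (induction A rule: infinite_finite_induct) (auto simp: frob_add)

lemma frob_eq_0_iff [simp]: "frob i x = 0 \<longleftrightarrow> x = 0"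
  by (simp add: frob_def)

lemma frob_comm: "frob i (frob j x) = frob j (frob i x)"
  by (simp add: frob_frob add.commute)

lemma GF_0 [simp]: "0 \<in> GF k" and GF_1 [simp]: "1 \<in> GF k"
  by (auto simp: GF_def)

lemma GF_add: "x \<in> GF k \<Longrightarrow> y \<in> GF k \<Longrightarrow> x + y \<in> GF k"
  and GF_mult: "x \<in> GF k \<Longrightarrow> y \<in> GF k \<Longrightarrow> x * y \<in> GF k"
  and GF_uminus: "x \<in> GF k \<Longrightarrow> - x \<in> GF k"
  and GF_diff: "x \<in> GF k \<Longrightarrow> y \<in> GF k \<Longrightarrow> x - y \<in> GF k"
  and GF_frob: "x \<in> GF k \<Longrightarrow> frob i x \<in> GF k"
  by (auto simp: GF_def frob_add frob_mult frob_minus frob_diff frob_comm[of k])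

lemma GF_inverse: "x \<in> GF k \<Longrightarrow> inverse x \<in> GF k"
  by (simp add: GF_def frob_def power_inverse)

lemma GF_sum: "(\<And>a. a \<in> A \<Longrightarrow> f a \<in> GF k) \<Longrightarrow> sum f A \<in> GF k"
  by (induction A rule: infinite_finite_induct) (auto intro: GF_add)

lemma frob_mult_GF: "x \<in> GF k \<Longrightarrow> frob (k * j) x = x"
  by (induction j) (auto simp: GF_def add.commute frob_frob[symmetric])

lemma GF_dvd: "k dvd l \<Longrightarrow> GF k \<subseteq> GF l"
  by (auto elim!: dvdE) (simp add: GF_def frob_mult_GF[unfolded GF_def])

lemma frob_mod: "x \<in> GF k \<Longrightarrow> frob (i mod k) x = frob i x"
  using frob_frob[of "i mod k" "k * (i div k)" x] frob_mult_GF[of x k "i div k"] by simp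

lemma GF_gcd: "x \<in> GF a \<Longrightarrow> x \<in> GF b \<Longrightarrow> x \<in> GF (gcd a b)"
proof (cases "a = 0")
  case False
  assume x: "x \<in> GF a" "x \<in> GF b"
  obtain u v where "a * u = b * v + gcd a b"
    using bezout_nat[OF False] by blast
  then have "frob (gcd a b) (frob (b * v) x) = frob (a * u) x" by (simp add: frob_frob add.commute)
  then show ?thesis using x by (simp add: frob_mult_GF GF_def)
qed auto

lemma of_nat_card_closure: "of_nat (CARD('f::{field,finite})) = (0 :: 'f alg_closure)"
  using binomial_card_eq_0_closure(1)[where 'f='f, of 1] card_gt_1[where 'f='f] by simp

text \<open>
  The polynomial \<open>x\<^bsup>q^k\<^esup> - x\<close> has derivative \<open>-1\<close>, so all its roots are simple and their number
  is its degree.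
\<close>

lemma card_GF:
  assumes "k > 0"
  shows "finite (GF k :: 'f::{field,finite} alg_closure set)"
    and "card (GF k :: 'f alg_closure set) = CARD('f) ^ k"
proof -
  define Q where "Q = CARD('f) ^ k"
  define P :: "'f alg_closure poly" where "P = monom 1 Q - monom 1 1"
  have Q: "Q > 1" unfolding Q_def by (rule one_less_power[OF card_gt_1 assms])
  have deg: "degree P = Q"
    unfolding P_def diff_conv_add_uminus using Q
    by (subst degree_add_eq_left) (auto simp: degree_monom_eq)
  have P0: "P \<noteq> 0" using deg Q by auto
  have Q0: "of_nat Q = (0 :: 'f alg_closure)"
    using assms of_nat_card_closure[where 'f='f] by (simp add: Q_def)
  have deriv: "pderiv P = -1"
    unfolding P_def by (simp add: pderiv_diff pderiv_monom Q0 flip: one_pCons)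
  have order: "order x P = 1" if x: "poly P x = 0" for x
  proof (rule ccontr)
    assume "order x P \<noteq> 1"
    moreover have "order x P \<noteq> 0" using x P0 by (simp add: order_root)
    ultimately have "order x P \<ge> 2" by linarith
    then have "[:- x, 1:]\<^sup>2 dvd P" using order_divides by blast
    then obtain g where "P = [:- x, 1:]\<^sup>2 * g" by (elim dvdE)
    then have "P = [:- x, 1:] * ([:- x, 1:] * g)" by (simp only: power2_eq_square mult.assoc)
    then have "poly (pderiv P) x = 0" by (simp only: pderiv_mult) simp
    then show False by (simp add: deriv)
  qed
  obtain A where A: "size A = degree P" "P = smult (lead_coeff P) (\<Prod>x\<in>#A. [:-x, 1:])"
    using alg_closed_imp_factorization[OF P0] by blast
  have roots: "{x. poly P x = 0} = GF k"
    by (auto simp: P_def GF_def frob_def poly_monom Q_def)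
  show fin: "finite (GF k :: 'f alg_closure set)"
    using poly_roots_finite[OF P0] by (simp add: roots)
  have "proots (\<Prod>x\<in>#B. [:-x, 1:]) = B \<and> (\<Prod>x\<in>#B. [:-x, 1:]) \<noteq> 0"
    for B :: "'f alg_closure multiset"
    by (induction B) (simp_all add: proots_mult del: mult_pCons_left)
  then have "proots P = A" using P0 by (subst A(2)) simp
  then have "size (proots P) = Q" using A deg by simp
  also have "size (proots P) = (\<Sum>x\<in>set_mset (proots P). count (proots P) x)"
    by (simp add: size_multiset_overloaded_eq)
  also have "\<dots> = (\<Sum>x\<in>(GF k :: 'f alg_closure set). 1)"
    using P0 by (intro sum.cong) (auto simp: roots[symmetric] order)
  finally show "card (GF k :: 'f alg_closure set) = CARD('f) ^ k" by (simp add: Q_def)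
qed

lemma GF_1_eq: "GF 1 = range (to_ac :: 'f::{field,finite} \<Rightarrow> _)"
proof (rule sym, rule card_subset_eq)
  show "finite (GF 1 :: 'f alg_closure set)" by (rule card_GF) simp
  show "card (range (to_ac :: 'f \<Rightarrow> _)) = card (GF 1 :: 'f alg_closure set)"
    by (simp add: card_GF card_image inj_to_ac)
  show "range (to_ac :: 'f \<Rightarrow> _) \<subseteq> GF 1"
    by (auto simp: GF_def frob_def power_card_eq_self simp flip: to_ac_power)
qed

lemma GF_to_ac: "to_ac x \<in> GF k"
  using GF_dvd[of 1 k] GF_1_eq by auto

lemma frob_to_ac [simp]: "frob k (to_ac x) = to_ac x"
  using GF_to_ac[of x k] by (simp add: GF_def)

section \<open>Linear operators on a finite field are linearized polynomials\<close>

text \<open>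
  A nonzero polynomial \<open>\<Sum>k<N. c k * x\<^bsup>q^k\<^esup>\<close> has at most \<open>q^(N - 1)\<close> roots, fewer than \<open>GF N\<close> has
  elements.
\<close>

lemma frob_independent:
  fixes c :: "nat \<Rightarrow> 'f::{field,finite} alg_closure"
  assumes zero: "\<And>v. v \<in> GF N \<Longrightarrow> (\<Sum>k<N. c k * frob k v) = 0" and k: "k < N"
  shows "c k = 0"
proof -
  define q where "q = CARD('f)"
  have q: "q > 1" using card_gt_1[where 'f='f] by (simp add: q_def)
  define P where "P = (\<Sum>k<N. monom (c k) (q ^ k))"
  have "P = 0"
  proof (rule ccontr)
    assume P: "P \<noteq> 0"
    have "GF N \<subseteq> {x. poly P x = 0}"
      using zero by (auto simp: P_def poly_sum poly_monom frob_def q_def)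
    then have "card (GF N :: 'f alg_closure set) \<le> card {x. poly P x = 0}"
      by (rule card_mono[OF poly_roots_finite[OF P]])
    also have "\<dots> \<le> degree P" by (rule card_poly_roots_bound[OF P])
    also have "\<dots> \<le> q ^ (N - 1)"
      unfolding P_def using q
      by (intro degree_sum_le) (auto intro!: order_trans[OF degree_monom_le] power_increasing)
    also have "\<dots> < q ^ N" using q k by (intro power_strict_increasing) auto
    finally show False using k by (simp add: card_GF q_def)
  qed
  moreover have "coeff P (q ^ k) = (\<Sum>i<N. if i = k then c i else 0)"
    unfolding P_def coeff_sum using q by (intro sum.cong) (auto simp: power_inject_exp)
  ultimately show ?thesis using k by simp
qed

definition linearized_on :: "nat \<Rightarrow> ('f::{field,finite} alg_closure \<Rightarrow> 'f alg_closure) \<Rightarrow> bool" where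
  "linearized_on N f \<longleftrightarrow>
     (\<exists>c. (\<forall>k. c k \<in> GF N) \<and> (\<forall>v\<in>GF N. f v = (\<Sum>k<N. c k * frob k v)))"

lemma linearized_on_0: "linearized_on N (\<lambda>v. 0)"
  unfolding linearized_on_def by (rule exI[of _ "\<lambda>k. 0"]) auto

lemma linearized_on_add:
  assumes "linearized_on N f" "linearized_on N g"
  shows "linearized_on N (\<lambda>v. f v + g v)"
proof -
  obtain c d where "\<forall>k. c k \<in> GF N" "\<forall>v\<in>GF N. f v = (\<Sum>k<N. c k * frob k v)"
    "\<forall>k. d k \<in> GF N" "\<forall>v\<in>GF N. g v = (\<Sum>k<N. d k * frob k v)"
    using assms unfolding linearized_on_def by blast
  then show ?thesis unfolding linearized_on_def
    by (intro exI[of _ "\<lambda>k. c k + d k"]) (auto simp: GF_add distrib_right sum.distrib)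
qed

lemma linearized_on_scale:
  assumes "linearized_on N f" "a \<in> GF N"
  shows "linearized_on N (\<lambda>v. a * f v)"
proof -
  obtain c where "\<forall>k. c k \<in> GF N" "\<forall>v\<in>GF N. f v = (\<Sum>k<N. c k * frob k v)"
    using assms unfolding linearized_on_def by blast
  then show ?thesis unfolding linearized_on_def using assms
    by (intro exI[of _ "\<lambda>k. a * c k"]) (auto simp: GF_mult sum_distrib_left mult.assoc)
qed

lemma linearized_on_sum:
  "(\<And>i. i \<in> I \<Longrightarrow> linearized_on N (f i)) \<Longrightarrow> linearized_on N (\<lambda>v. \<Sum>i\<in>I. f i v)"
  by (induction I rule: infinite_finite_induct) (auto intro: linearized_on_0 linearized_on_add)

lemma linearized_on_frob:
  assumes "N > 0"
  shows "linearized_on N (frob i)"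
proof -
  have "frob i v = (\<Sum>k<N. (if k = i mod N then 1 else 0) * frob k v)" if "v \<in> GF N" for v
    using assms frob_mod[OF that, of i] by (simp add: if_distrib if_distribR cong: if_cong)
  then show ?thesis unfolding linearized_on_def
    by (intro exI[of _ "\<lambda>k. if k = i mod N then 1 else 0"]) auto
qed

lemma linearized_on_frob_comp:
  assumes "N > 0" "linearized_on N f"
  shows "linearized_on N (\<lambda>v. frob i (f v))"
proof -
  obtain c where c: "\<forall>k. c k \<in> GF N" "\<forall>v\<in>GF N. f v = (\<Sum>k<N. c k * frob k v)"
    using assms unfolding linearized_on_def by blast
  have "linearized_on N (\<lambda>v. \<Sum>k<N. frob i (c k) * frob (i + k) v)"
    using c assms by (intro linearized_on_sum linearized_on_scale linearized_on_frob GF_frob) auto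
  then show ?thesis using c
    by (simp add: linearized_on_def frob_sum frob_mult frob_frob)
qed

lemma linearized_on_diff:
  assumes "linearized_on N f" "linearized_on N g"
  shows "linearized_on N (\<lambda>v. f v - g v)"
  using linearized_on_add[OF assms(1) linearized_on_scale[OF assms(2), of "- 1"]]
  by (simp add: GF_uminus)

lemma linearized_on_closed: "linearized_on N f \<Longrightarrow> v \<in> GF N \<Longrightarrow> f v \<in> GF N"
  by (auto simp: linearized_on_def intro!: GF_sum GF_mult GF_frob)

lemma linearized_on_linear:
  assumes "linearized_on N f" "v \<in> GF N" "w \<in> GF N"
  shows "f (w - to_ac a * v) = f w - to_ac a * f v"
proof -
  obtain c where c: "\<forall>v\<in>GF N. f v = (\<Sum>k<N. c k * frob k v)"
    using assms unfolding linearized_on_def by blast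
  have "w - to_ac a * v \<in> GF N" using assms by (intro GF_diff GF_mult GF_to_ac)
  then show ?thesis using c assms
    by (simp add: frob_diff frob_mult algebra_simps sum_subtractf sum_distrib_left)
qed

text \<open>
  Newton interpolation: along a growing finite set \<open>Z\<close> one keeps a linearized polynomial \<open>P\<close> that
  vanishes on \<open>Z\<close> and a linearized polynomial \<open>L\<close> that agrees with the given operator on the whole
  kernel of \<open>P\<close>. When \<open>Z\<close> is the whole field, \<open>P\<close> vanishes everywhere and \<open>L\<close> is the operator.
\<close>

lemma linearized_on_of_linear:
  fixes f :: "'f::{field,finite} alg_closure \<Rightarrow> 'f alg_closure"
  assumes N: "N > 0" and closed: "\<And>v. v \<in> GF N \<Longrightarrow> f v \<in> GF N"
    and add: "\<And>v w. v \<in> GF N \<Longrightarrow> w \<in> GF N \<Longrightarrow> f (v + w) = f v + f w"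
    and scale: "\<And>a v. v \<in> GF N \<Longrightarrow> f (to_ac a * v) = to_ac a * f v"
  shows "linearized_on N f"
proof -
  have f_lin: "f (w - to_ac a * v) = f w - to_ac a * f v" if "v \<in> GF N" "w \<in> GF N" for v w a
    using add[of w "to_ac (- a) * v"] scale[of v "- a"] that by (simp add: GF_uminus GF_mult GF_to_ac)
  have "\<exists>P L. linearized_on N P \<and> linearized_on N L \<and> (\<forall>v\<in>Z. P v = 0) \<and>
          (\<forall>v\<in>GF N. P v = 0 \<longrightarrow> f v = L v)" if "finite Z" "Z \<subseteq> GF N" for Z
    using that
  proof (induction Z rule: finite_induct)
    case empty
    have "f 0 = 0" using f_lin[of 0 0 1] by simp
    then show ?case
      using linearized_on_frob[OF N, of 0] linearized_on_0[of N]
      by (intro exI[of _ "\<lambda>v. v"] exI[of _ "\<lambda>v. 0"]) (auto simp: linearized_on_def)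
  next
    case (insert v Z)
    then obtain P L where P: "linearized_on N P" and L: "linearized_on N L"
      and PZ: "\<forall>v\<in>Z. P v = 0" and eq: "\<And>v. v \<in> GF N \<Longrightarrow> P v = 0 \<Longrightarrow> f v = L v" by blast
    have v: "v \<in> GF N" using insert by simp
    show ?case
    proof (cases "P v = 0")
      case True
      then show ?thesis using P L PZ eq by blast
    next
      case False
      \<comment> \<open>The constant \<open>b\<close> makes \<open>P'\<close> vanish at \<open>v\<close>, and \<open>c\<close> corrects the value of \<open>L\<close> at \<open>v\<close>.\<close>
      define b where "b = frob 1 (P v) / P v"
      define c where "c = (f v - L v) / P v"
      define P' where "P' = (\<lambda>w. frob 1 (P w) - b * P w)"
      define L' where "L' = (\<lambda>w. L w + c * P w)"
      have "P v \<in> GF N" "f v - L v \<in> GF N"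
        using v P L by (simp_all add: linearized_on_closed closed GF_diff)
      then have bc: "b \<in> GF N" "c \<in> GF N"
        by (simp_all add: b_def c_def divide_inverse GF_mult GF_inverse GF_frob)
      have lin: "linearized_on N P'" "linearized_on N L'"
        unfolding P'_def L'_def using P L N bc
        by (auto intro: linearized_on_diff linearized_on_add linearized_on_scale linearized_on_frob_comp)
      have "f w = L' w" if w: "w \<in> GF N" "P' w = 0" for w
      proof -
        \<comment> \<open>\<open>P w / P v\<close> is fixed by the Frobenius, so \<open>w\<close> minus an \<open>\<F>\<^sub>q\<close>-multiple of \<open>v\<close> is in the
            kernel of \<open>P\<close>.\<close>
        have "frob 1 (P w / P v) * frob 1 (P v) = frob 1 (P w)"
          using False by (simp flip: frob_mult)
        also have "\<dots> = P w / P v * frob 1 (P v)"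
          using w by (simp add: P'_def b_def)
        finally have "P w / P v \<in> GF 1"
          unfolding GF_def mem_Collect_eq by (subst (asm) mult_right_cancel) (use False in auto)
        then obtain a where a: "P w / P v = to_ac a" using GF_1_eq by auto
        have "P (w - to_ac a * v) = 0"
          using linearized_on_linear[OF P v w(1), of a] False by (simp flip: a)
        then have "f (w - to_ac a * v) = L (w - to_ac a * v)"
          using v w by (intro eq) (auto intro: GF_diff GF_mult GF_to_ac)
        then have "f w - to_ac a * f v = L w - to_ac a * L v"
          by (simp only: f_lin[OF v w(1)] linearized_on_linear[OF L v w(1)])
        then have "f w = L w + to_ac a * (f v - L v)" by (simp add: algebra_simps)
        then show ?thesis by (simp add: L'_def c_def flip: a)
      qed
      moreover have "\<forall>w\<in>insert v Z. P' w = 0"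
        using False PZ by (simp add: P'_def b_def)
      ultimately show ?thesis using lin by blast
    qed
  qed
  from this[OF card_GF(1)[OF N] order_refl] obtain P L where L: "linearized_on N P" "linearized_on N L"
    and eq: "\<forall>v\<in>GF N. P v = 0" "\<forall>v\<in>GF N. P v = 0 \<longrightarrow> f v = L v"
    by blast
  from eq have "\<forall>v\<in>GF N. f v = L v" by blast
  then show ?thesis using L unfolding linearized_on_def by metis
qed

section \<open>Evaluation of twisted polynomials\<close>

lemma twisted_apply_eq:
  "degree f \<le> d \<Longrightarrow> twisted_apply f v = (\<Sum>i\<le>d. coeff f i * frob i v)"
  unfolding twisted_apply_def
  by (rule sum.mono_neutral_left) (auto simp: coeff_eq_0)

lemma twisted_apply_add: "twisted_apply (f + g) v = twisted_apply f v + twisted_apply g v"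
proof -
  let ?d = "max (degree f) (degree g)"
  have "twisted_apply (f + g) v = (\<Sum>i\<le>?d. coeff (f + g) i * frob i v)"
    by (rule twisted_apply_eq) (rule degree_add_le_max)
  then show ?thesis
    by (simp add: twisted_apply_eq[of f ?d] twisted_apply_eq[of g ?d] distrib_right sum.distrib)
qed

lemma twisted_apply_0 [simp]: "twisted_apply 0 v = 0"
  by (simp add: twisted_apply_def)

lemma twisted_apply_sum: "twisted_apply (sum f A) v = (\<Sum>a\<in>A. twisted_apply (f a) v)"
  by (induction A rule: infinite_finite_induct) (auto simp: twisted_apply_add)

lemma twisted_apply_monom: "twisted_apply (monom a k) v = a * frob k v"
  by (simp add: twisted_apply_eq[OF degree_monom_le] if_distrib if_distribR cong: if_cong)

lemma twisted_apply_const: "twisted_apply [:a:] v = a * v"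
  using twisted_apply_monom[of a 0 v] by (simp add: monom_0)

lemma twisted_apply_mult: "twisted_apply (twisted_mult f g) v = twisted_apply f (twisted_apply g v)"
  unfolding twisted_mult_def twisted_apply_sum twisted_apply_monom
  by (simp add: twisted_apply_def frob_sum frob_mult frob_frob sum_distrib_left mult.assoc)

section \<open>The operator \<open>t + \<tau>\<^sup>n\<close> and its commutant\<close>

lemma map_poly_to_ac_mult: "map_poly to_ac (f * g) = map_poly to_ac f * map_poly to_ac g"
  by (rule poly_eqI) (simp add: coeff_map_poly coeff_mult to_ac_sum)

lemma map_poly_to_ac_add: "map_poly to_ac (f + g) = map_poly to_ac f + map_poly to_ac g"
  by (rule poly_eqI) (simp add: coeff_map_poly)

lemma map_poly_to_ac_diff: "map_poly to_ac (f - g) = map_poly to_ac f - map_poly to_ac g"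
  by (rule poly_eqI) (simp add: coeff_map_poly)

lemma degree_map_poly_to_ac: "degree (map_poly to_ac f) = degree f"
  by (rule degree_map_poly) simp

lemma map_poly_frob_mult: "map_poly (frob k) (f * g) = map_poly (frob k) f * map_poly (frob k) g"
  by (rule poly_eqI) (simp add: coeff_map_poly coeff_mult frob_sum frob_mult)

lemma coeff_mult_GF:
  "(\<And>i. coeff f i \<in> GF k) \<Longrightarrow> (\<And>i. coeff g i \<in> GF k) \<Longrightarrow> coeff (f * g) i \<in> GF k"
  by (simp add: coeff_mult GF_sum GF_mult)

text \<open>
  A polynomial of least degree among the nonzero polynomials over \<open>\<F>\<^sub>q\<close> vanishing at \<open>t\<close> divides \<open>p0\<close>,
  hence has the degree of \<open>p0\<close>.
\<close>

lemma irreducible_root_minimal: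
  fixes p0 :: "'f::{field,finite} poly"
  assumes irr: "irreducible p0" and root: "poly (map_poly to_ac p0) t = 0"
    and h: "poly (map_poly to_ac h) t = 0" "degree h < degree p0"
  shows "h = 0"
proof (rule ccontr)
  assume "h \<noteq> 0"
  define is_ann where "is_ann g \<longleftrightarrow> g \<noteq> 0 \<and> poly (map_poly to_ac g) t = 0" for g
  obtain g where g: "is_ann g" and min: "\<And>g'. is_ann g' \<Longrightarrow> degree g \<le> degree g'"
    using exists_least_iff[of "\<lambda>d. \<exists>g. is_ann g \<and> degree g = d"] h(1) \<open>h \<noteq> 0\<close>
    by (metis is_ann_def linorder_not_less)
  have "map_poly to_ac p0 = map_poly to_ac (p0 div g) * map_poly to_ac g + map_poly to_ac (p0 mod g)"
    by (simp flip: map_poly_to_ac_mult map_poly_to_ac_add)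
  then have "poly (map_poly to_ac (p0 mod g)) t = 0"
    using root g by (simp add: is_ann_def)
  moreover have "g \<noteq> 0" using g by (simp add: is_ann_def)
  ultimately have "p0 mod g = 0"
    using degree_mod_less'[of g p0] min[of "p0 mod g"] unfolding is_ann_def
    by (meson linorder_not_less)
  then have "g dvd p0" by (simp add: mod_eq_0_iff_dvd)
  then have p0: "p0 = g * (p0 div g)" by (rule dvd_mult_div_cancel[symmetric])
  have "\<not> g dvd 1"
  proof
    assume "g dvd 1"
    then have "degree g = 0" by (metis is_unit_iff_degree one_neq_zero dvd_0_left_iff)
    then obtain a where "g = [:a:]" by (rule degree_eq_zeroE)
    then show False using g by (simp add: is_ann_def map_poly_pCons)
  qed
  then have "(p0 div g) dvd 1" using irreducibleD[OF irr p0] by blast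
  then have "degree (p0 div g) = 0" by (metis is_unit_iff_degree one_neq_zero dvd_0_left_iff)
  moreover have "p0 \<noteq> 0" using irr by auto
  ultimately have "degree p0 = degree g"
    using p0 by (metis degree_mult_eq mult_zero_left mult_zero_right add.right_neutral)
  then show False using min[of h] h \<open>h \<noteq> 0\<close> by (auto simp: is_ann_def)
qed

locale twisted_binomial =
  fixes t :: "'f::{field,finite} alg_closure" and n m r :: nat
  assumes n_pos: "n > 0" and r_pos: "r > 0" and coprime_n_r: "coprime n r"
    and m_dvd: "m dvd n" and t_GF: "t \<in> GF r"
begin

abbreviation V :: "'f alg_closure set" where "V \<equiv> GF (n * r)"

definition T :: "'f alg_closure \<Rightarrow> 'f alg_closure" where "T v = t * v + frob n v"

lemma T_add: "T (v + w) = T v + T w"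
  by (simp add: T_def frob_add algebra_simps)

lemma T_0 [simp]: "T 0 = 0" by (simp add: T_def)

lemma T_mult_GF: "c \<in> GF n \<Longrightarrow> T (c * v) = c * T v"
  by (simp add: T_def frob_mult GF_def algebra_simps)

lemma T_frob: "T (frob (r * j) v) = frob (r * j) (T v)"
  using frob_mult_GF[OF t_GF, of j] by (simp add: T_def frob_add frob_mult frob_comm[of n])

lemma GF_sub_V: "GF n \<subseteq> V" "GF r \<subseteq> V" "GF m \<subseteq> GF n" "GF m \<subseteq> V"
  using m_dvd GF_dvd[of m n] GF_dvd[of n "n * r"] GF_dvd[of r "n * r"] by auto

lemma T_V: "v \<in> V \<Longrightarrow> T v \<in> V"
  unfolding T_def using t_GF GF_sub_V by (intro GF_add GF_mult GF_frob) auto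

lemma Tpow_V: "v \<in> V \<Longrightarrow> (T ^^ i) v \<in> V"
  by (induction i) (auto intro: T_V)

lemma Tpow_add: "(T ^^ i) (v + w) = (T ^^ i) v + (T ^^ i) w"
  by (induction i) (auto simp: T_add)

lemma Tpow_0 [simp]: "(T ^^ i) 0 = 0"
  by (induction i) auto

lemma Tpow_sum: "(T ^^ i) (sum f A) = (\<Sum>a\<in>A. (T ^^ i) (f a))"
  by (induction A rule: infinite_finite_induct) (auto simp: Tpow_add)

lemma Tpow_mult_GF: "c \<in> GF n \<Longrightarrow> (T ^^ i) (c * v) = c * (T ^^ i) v"
  by (induction i) (auto simp: T_mult_GF)

lemma Tpow_frob: "(T ^^ i) (frob (r * j) v) = frob (r * j) ((T ^^ i) v)"
  by (induction i) (auto simp: T_frob)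

text \<open>
  Substituting \<open>T\<close> for the variable, with coefficients on the left. This is not multiplicative, but
  multiplying on the right by \<open>X - a\<close> is easy to follow.
\<close>

definition eval_T :: "'f alg_closure poly \<Rightarrow> 'f alg_closure \<Rightarrow> 'f alg_closure" where
  "eval_T P v = (\<Sum>l\<le>degree P. coeff P l * (T ^^ l) v)"

lemma eval_T_eq: "degree P \<le> d \<Longrightarrow> eval_T P v = (\<Sum>l\<le>d. coeff P l * (T ^^ l) v)"
  unfolding eval_T_def by (rule sum.mono_neutral_left) (auto simp: coeff_eq_0)

lemma eval_T_add: "eval_T (P + Q) v = eval_T P v + eval_T Q v"
proof -
  let ?d = "max (degree P) (degree Q)"
  have "eval_T (P + Q) v = (\<Sum>l\<le>?d. coeff (P + Q) l * (T ^^ l) v)"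
    by (rule eval_T_eq) (rule degree_add_le_max)
  then show ?thesis
    by (simp add: eval_T_eq[of P ?d] eval_T_eq[of Q ?d] distrib_right sum.distrib)
qed

lemma eval_T_smult: "eval_T (smult a P) v = a * eval_T P v"
  using eval_T_eq[OF degree_smult_le[of a P], of v]
  by (simp add: eval_T_def sum_distrib_left mult.assoc)

lemma eval_T_pCons: "eval_T (pCons a P) v = a * v + eval_T P (T v)"
proof -
  have "eval_T (pCons a P) v = (\<Sum>l\<le>Suc (degree P). coeff (pCons a P) l * (T ^^ l) v)"
    by (rule eval_T_eq) (rule degree_pCons_le)
  then show ?thesis
    by (subst (asm) sum.atMost_Suc_shift) (simp add: eval_T_def funpow_swap1)
qed

definition conj_prod :: "nat \<Rightarrow> 'f alg_closure poly" where
  "conj_prod k = (\<Prod>i<k. [:- frob (n * i) t, 1:])"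

text \<open>
  Since \<open>\<tau>\<^bsup>nk\<^esup> t = frob (n * k) t \<tau>\<^bsup>nk\<^esup>\<close>, composing \<open>\<tau>\<^bsup>nk\<^esup>\<close> with \<open>T = t + \<tau>\<^sup>n\<close> and subtracting
  \<open>frob (n * k) t\<close> times \<open>\<tau>\<^bsup>nk\<^esup>\<close> leaves exactly \<open>\<tau>\<^bsup>n(k+1)\<^esup>\<close>.
\<close>

lemma eval_T_conj_prod: "eval_T (conj_prod k) v = frob (n * k) v"
proof (induction k arbitrary: v)
  case 0
  show ?case by (simp add: conj_prod_def eval_T_def)
next
  case (Suc k)
  have "conj_prod (Suc k) = smult (- frob (n * k) t) (conj_prod k) + pCons 0 (conj_prod k)"
    by (simp add: conj_prod_def mult.commute)
  then have "eval_T (conj_prod (Suc k)) v = - frob (n * k) t * frob (n * k) v + frob (n * k) (T v)"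
    by (simp only: eval_T_add eval_T_smult eval_T_pCons Suc.IH mult_zero_left add_0_left)
  then show ?case
    by (simp add: T_def frob_add frob_mult frob_frob add.commute)
qed

lemma degree_conj_prod: "degree (conj_prod k) = k"
  by (simp add: conj_prod_def degree_prod_eq_sum_degree)

lemma lead_coeff_conj_prod: "coeff (conj_prod k) k = 1"
proof -
  have "lead_coeff (conj_prod k) = 1" by (simp add: conj_prod_def lead_coeff_prod)
  then show ?thesis by (simp add: degree_conj_prod)
qed

lemma coeff_conj_prod_GF: "coeff (conj_prod k) i \<in> GF r"
proof (induction k arbitrary: i)
  case 0
  show ?case by (simp add: conj_prod_def)
next
  case (Suc k)
  have "conj_prod (Suc k) = conj_prod k * [:- frob (n * k) t, 1:]"
    by (simp add: conj_prod_def mult.commute)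
  moreover have "coeff [:- frob (n * k) t, 1:] i \<in> GF r" for i
    using t_GF by (auto simp: coeff_pCons GF_uminus GF_frob split: nat.split)
  ultimately show ?case using Suc.IH by (simp only: coeff_mult_GF)
qed

text \<open>
  \<open>frob n\<close> permutes the factors of \<open>conj_prod r\<close> cyclically, so it fixes the coefficients; they also lie
  in \<open>GF r\<close>, and \<open>n\<close> is coprime to \<open>r\<close>.
\<close>

lemma coeff_conj_prod_r: "coeff (conj_prod r) i \<in> range to_ac"
proof -
  let ?g = "\<lambda>i. [:- frob (n * i) t, 1:]"
  have "map_poly (frob n) (\<Prod>i<k. ?g i) = (\<Prod>i<k. ?g (Suc i))" for k
    by (induction k)
       (simp_all add: map_poly_frob_mult map_poly_pCons frob_minus frob_frob del: mult_pCons_right)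
  moreover have "?g 0 * (\<Prod>i<r. ?g (Suc i)) = ?g 0 * (\<Prod>i<r. ?g i)"
  proof -
    have "?g r = ?g 0" using frob_mult_GF[OF t_GF, of n] by (simp add: mult.commute)
    then show ?thesis
      using prod.lessThan_Suc_shift[of ?g r] prod.lessThan_Suc[of ?g r] by (simp only: mult.commute)
  qed
  then have "(\<Prod>i<r. ?g (Suc i)) = (\<Prod>i<r. ?g i)" by (subst (asm) mult_left_cancel) auto
  ultimately have "map_poly (frob n) (conj_prod r) = conj_prod r"
    by (simp only: conj_prod_def)
  then have "frob n (coeff (conj_prod r) i) = coeff (conj_prod r) i"
    by (metis coeff_map_poly frob_0)
  then have "coeff (conj_prod r) i \<in> GF n" by (simp add: GF_def)
  from GF_gcd[OF this coeff_conj_prod_GF] coprime_n_r show ?thesis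
    by (simp add: coprime_iff_gcd_eq_1 GF_1_eq[symmetric])
qed

text \<open>
  Both sides are monic of degree \<open>r\<close> over \<open>\<F>\<^sub>q\<close> and vanish at \<open>t\<close>, so their difference is zero by
  minimality. Evaluated at \<open>T\<close> this says that \<open>p0\<close> acts as \<open>\<tau>\<^bsup>nr\<^esup>\<close>.
\<close>

lemma irreducible_eq_conj_prod:
  assumes "lead_coeff p0 = 1" "irreducible p0" "degree p0 = r" "poly (map_poly to_ac p0) t = 0"
  shows "map_poly to_ac p0 = conj_prod r"
proof -
  define g where "g = map_poly of_ac (conj_prod r)"
  have g: "map_poly to_ac g = conj_prod r"
    by (rule poly_eqI) (simp add: g_def coeff_map_poly to_ac_of_ac coeff_conj_prod_r)
  have deg: "degree g = r" using degree_map_poly_to_ac[of g] by (simp add: g degree_conj_prod)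
  have "to_ac (coeff g r) = 1"
    using lead_coeff_conj_prod[of r] by (simp flip: g add: coeff_map_poly)
  then have "coeff (p0 - g) r = 0" using assms by simp
  moreover have "degree (p0 - g) \<le> r" using deg assms by (intro degree_diff_le) auto
  ultimately have "degree (p0 - g) < degree p0"
    using r_pos assms(3) by (metis degree_0 le_neq_implies_less leading_coeff_0_iff)
  moreover have "poly (conj_prod r) t = 0"
  proof -
    have "poly (conj_prod r) t = (\<Prod>i<r. t - frob (n * i) t)"
      by (simp add: conj_prod_def poly_prod)
    also have "\<dots> = 0" using r_pos by (intro prod_zero) (auto intro: bexI[of _ 0])
    finally show ?thesis .
  qed
  then have "poly (map_poly to_ac (p0 - g)) t = 0"
    using assms(4) by (simp add: map_poly_to_ac_diff g)
  ultimately have "p0 - g = 0" using irreducible_root_minimal assms(2,4) by blast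
  then show ?thesis using g by simp
qed

subsection \<open>A basis of the linear operators\<close>

definition idx :: "(nat \<times> nat) set" where "idx = {..<r} \<times> {..<n}"

definition mono_op :: "nat \<times> nat \<Rightarrow> 'f alg_closure \<Rightarrow> 'f alg_closure" where
  "mono_op x v = (T ^^ fst x) (frob (r * snd x) v)"

definition comb :: "(nat \<times> nat \<Rightarrow> 'f alg_closure) \<Rightarrow> 'f alg_closure \<Rightarrow> 'f alg_closure" where
  "comb c v = (\<Sum>x\<in>idx. c x * mono_op x v)"

lemma finite_idx [simp]: "finite idx" by (simp add: idx_def)

lemma mono_op_V: "v \<in> V \<Longrightarrow> mono_op x v \<in> V"
  by (simp add: mono_op_def Tpow_V GF_frob)

lemma mono_op_add: "mono_op x (v + w) = mono_op x v + mono_op x w"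
  by (simp add: mono_op_def frob_add Tpow_add)

lemma mono_op_T: "mono_op x (T v) = T (mono_op x v)"
  by (simp add: mono_op_def funpow_swap1 flip: T_frob)

lemma mono_op_frob: "mono_op x (frob (r * j) v) = frob (r * j) (mono_op x v)"
  by (simp add: mono_op_def frob_comm[of "r * snd x"] flip: Tpow_frob)

lemma comb_V: "(\<And>x. c x \<in> V) \<Longrightarrow> v \<in> V \<Longrightarrow> comb c v \<in> V"
  by (simp add: comb_def GF_sum GF_mult mono_op_V)

text \<open>
  By the Chinese remainder theorem \<open>k \<equiv> n i + r j\<close> modulo \<open>n r\<close> with \<open>i < r\<close> and \<open>j < n\<close>, and
  \<open>\<tau>\<^bsup>ni\<^esup>\<close> is a combination of \<open>1, T, \<dots>, T\<^sup>i\<close> by \<open>eval_T_conj_prod\<close>.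
\<close>

lemma frob_eq_comb: "\<exists>c. (\<forall>x. c x \<in> V) \<and> (\<forall>v\<in>V. frob k v = comb c v)"
proof -
  obtain x y where xy: "[n * x = 1] (mod r)" "[r * y = 1] (mod n)"
    using cong_solve_coprime_nat[of n r] cong_solve_coprime_nat[of r n] coprime_n_r
    by (auto simp: coprime_commute)
  define i where "i = (x * k) mod r"
  define j where "j = (y * k) mod n"
  have ij: "i < r" "j < n" using r_pos n_pos by (auto simp: i_def j_def)
  have "[n * i = n * (x * k)] (mod r)" "[r * j = r * (y * k)] (mod n)"
    by (auto simp: i_def j_def intro!: cong_mult)
  moreover have "[n * (x * k) = 1 * k] (mod r)" "[r * (y * k) = 1 * k] (mod n)"
    using cong_mult[OF xy(1) cong_refl[of k]] cong_mult[OF xy(2) cong_refl[of k]]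
    by (auto simp: mult.assoc)
  ultimately have "[n * i = k] (mod r)" "[r * j = k] (mod n)" by (auto intro: cong_trans)
  then have "[n * i + r * j = k] (mod r)" "[n * i + r * j = k] (mod n)"
    by (auto simp: cong_def)
  then have k: "[n * i + r * j = k] (mod n * r)"
    using coprime_n_r by (simp add: coprime_cong_mult_nat)
  define d where "d = (\<lambda>x. if snd x = j \<and> fst x \<le> i then coeff (conj_prod i) (fst x) else 0)"
  have "frob k v = comb d v" if v: "v \<in> V" for v
  proof -
    have "frob k v = frob (n * i + r * j) v"
      using k frob_mod[OF v, of k] frob_mod[OF v, of "n * i + r * j"] by (simp add: cong_def)
    also have "\<dots> = eval_T (conj_prod i) (frob (r * j) v)"
      by (simp add: eval_T_conj_prod frob_frob)
    also have "\<dots> = (\<Sum>l\<le>i. coeff (conj_prod i) l * mono_op (l, j) v)"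
      by (simp add: eval_T_def degree_conj_prod mono_op_def)
    also have "\<dots> = (\<Sum>x\<in>(\<lambda>l. (l, j)) ` {..i}. d x * mono_op x v)"
      by (subst sum.reindex) (auto simp: d_def inj_on_def)
    also have "\<dots> = comb d v"
      unfolding comb_def using ij
      by (intro sum.mono_neutral_left) (auto simp: d_def idx_def)
    finally show ?thesis .
  qed
  moreover have "d x \<in> V" for x using coeff_conj_prod_GF GF_sub_V by (auto simp: d_def)
  ultimately show ?thesis by blast
qed

lemma linearized_on_eq_comb:
  assumes "linearized_on (n * r) f"
  shows "\<exists>c. (\<forall>x. c x \<in> V) \<and> (\<forall>v\<in>V. f v = comb c v)"
proof -
  obtain a where a: "\<forall>k. a k \<in> V" "\<forall>v\<in>V. f v = (\<Sum>k<n * r. a k * frob k v)"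
    using assms unfolding linearized_on_def by blast
  obtain d where d: "\<forall>k x. d k x \<in> V" "\<forall>k. \<forall>v\<in>V. frob k v = comb (d k) v"
    using frob_eq_comb by metis
  define c where "c = (\<lambda>x. \<Sum>k<n * r. a k * d k x)"
  have "f v = comb c v" if "v \<in> V" for v
    using a d that unfolding comb_def c_def
    by (simp add: sum_distrib_left sum_distrib_right mult.assoc) (rule sum.swap)
  moreover have "c x \<in> V" for x unfolding c_def by (intro GF_sum GF_mult a(1)[rule_format] d(1)[rule_format])
  ultimately show ?thesis by blast
qed

text \<open>
  The spanning families \<open>mono_op\<close> and \<open>frob\<close> have the same number of elements, and the second one is
  independent; by counting, so is the first.
\<close>

lemma comb_inj:
  assumes c: "\<And>x. c x \<in> V" and d: "\<And>x. d x \<in> V" and eq: "\<And>v. v \<in> V \<Longrightarrow> comb c v = comb d v"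
    and x: "x \<in> idx"
  shows "c x = d x"
proof -
  let ?A = "idx \<rightarrow>\<^sub>E V" and ?B = "{..<n * r} \<rightarrow>\<^sub>E V"
  define F where "F = (\<lambda>c. restrict (comb c) V)"
  define G where "G = (\<lambda>a. restrict (\<lambda>v. \<Sum>k<n * r. a k * frob k v) V)"
  have N: "n * r > 0" using n_pos r_pos by simp
  have finV: "finite V" by (rule card_GF[OF N])
  have card: "card ?A = card ?B" by (simp add: card_PiE idx_def mult.commute)
  have finA: "finite ?A" using finV by (intro finite_PiE) auto
  have "inj_on G ?B"
  proof (rule inj_onI)
    fix a b assume ab: "a \<in> ?B" "b \<in> ?B" "G a = G b"
    have "a k - b k = 0" if "k < n * r" for k
    proof (rule frob_independent[where c = "\<lambda>k. a k - b k", OF _ that])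
      fix v assume v: "v \<in> V"
      from ab(3) have "G a v = G b v" by simp
      then show "(\<Sum>k<n * r. (a k - b k) * frob k v) = 0"
        using v by (simp add: G_def left_diff_distrib sum_subtractf)
    qed
    then show "a = b" using ab by (intro PiE_ext[of a _ _ b]) auto
  qed
  moreover have "G ` ?B \<subseteq> F ` ?A"
  proof clarify
    fix a assume a: "a \<in> ?B"
    have "linearized_on (n * r) (\<lambda>v. \<Sum>k<n * r. a k * frob k v)"
      using a N by (intro linearized_on_sum linearized_on_scale linearized_on_frob) (auto simp: PiE_iff)
    then obtain c where c: "\<forall>x. c x \<in> V" "\<forall>v\<in>V. (\<Sum>k<n * r. a k * frob k v) = comb c v"
      using linearized_on_eq_comb by blast
    have "G a = F (restrict c idx)"
      using c(2) by (auto simp: G_def F_def comb_def intro!: restrict_ext)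
    moreover have "restrict c idx \<in> ?A" using c(1) by auto
    ultimately show "G a \<in> F ` ?A" by (rule image_eqI)
  qed
  ultimately have "card ?A \<le> card (F ` ?A)"
    using card_mono[OF finite_imageI[OF finA], of "G ` ?B"] by (simp add: card card_image)
  then have "inj_on F ?A" using finA card_image_le[OF finA, of F] by (intro eq_card_imp_inj_on) auto
  moreover have "F (restrict c idx) = F (restrict d idx)"
    using eq by (auto simp: F_def comb_def intro!: restrict_ext)
  ultimately have "restrict c idx = restrict d idx" using c d by (auto dest!: inj_onD)
  then show ?thesis using x by (metis restrict_apply')
qed

text \<open>
  Commuting with \<open>frob (r * m)\<close> forces the coefficients into \<open>GF (r * m)\<close>. Commuting with \<open>T\<close> forces
  them into \<open>GF n\<close>, because the commutator of \<open>T\<close> with a scalar \<open>c\<close> is \<open>(frob n c - c) * frob n\<close>.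
  Both together leave \<open>GF m\<close>, as \<open>gcd (r * m) n = m\<close>.
\<close>

lemma commutant_eq_comb:
  assumes lin: "linearized_on (n * r) f"
    and T: "\<And>v. v \<in> V \<Longrightarrow> f (T v) = T (f v)"
    and frob: "\<And>v. v \<in> V \<Longrightarrow> f (frob (r * m) v) = frob (r * m) (f v)"
  shows "\<exists>c. (\<forall>x. c x \<in> GF m) \<and> (\<forall>v\<in>V. f v = comb c v)"
proof -
  obtain c where c: "\<And>x. c x \<in> V" "\<And>v. v \<in> V \<Longrightarrow> f v = comb c v"
    using linearized_on_eq_comb[OF lin] by blast
  have "m \<le> n" using m_dvd n_pos by (simp add: dvd_imp_le)
  then have le: "r * m \<le> n * r" by (simp add: mult.commute)
  have "c x \<in> GF (r * m)" if x: "x \<in> idx" for x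
  proof -
    have "comb (\<lambda>x. frob (r * m) (c x)) w = comb c w" if w: "w \<in> V" for w
    proof -
      define v where "v = frob (n * r - r * m) w"
      have v: "v \<in> V" "frob (r * m) v = w"
        using w le by (auto simp: v_def GF_frob frob_frob) (simp add: GF_def)
      have "comb (\<lambda>x. frob (r * m) (c x)) w = frob (r * m) (comb c v)"
        by (simp add: comb_def frob_sum frob_mult mono_op_frob flip: v(2))
      also have "\<dots> = comb c w" using frob[OF v(1)] c(2) v GF_frob by metis
      finally show ?thesis .
    qed
    moreover have "frob (r * m) (c x) \<in> V" for x using c(1) by (rule GF_frob)
    ultimately have "frob (r * m) (c x) = c x"
      using comb_inj[of "\<lambda>x. frob (r * m) (c x)" c, OF _ c(1) _ x] by blast
    then show ?thesis by (simp add: GF_def)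
  qed
  moreover have "c x \<in> GF n" if x: "x \<in> idx" for x
  proof -
    define d where "d = (\<lambda>x. frob (n * r - n) (frob n (c x) - c x))"
    \<comment> \<open>The exponent \<open>n * r - n\<close> inverts \<open>frob n\<close> on \<open>V\<close> and turns the commutator into a \<open>comb\<close>.\<close>
    have "comb d v = comb (\<lambda>x. 0) v" if v: "v \<in> V" for v
    proof -
      have n_le: "n * r - n + n = n * r" using r_pos by (simp add: add.commute)
      have "comb c (T v) = T (comb c v)" using T[OF v] c(2) v T_V by metis
      then have "(\<Sum>x\<in>idx. c x * frob n (mono_op x v)) = (\<Sum>x\<in>idx. frob n (c x) * frob n (mono_op x v))"
        by (simp add: comb_def mono_op_T) (simp add: T_def distrib_left sum.distrib sum_distrib_left
            frob_sum frob_mult mult.left_commute)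
      then have "0 = frob (n * r - n) (\<Sum>x\<in>idx. (frob n (c x) - c x) * frob n (mono_op x v))"
        by (simp add: left_diff_distrib sum_subtractf)
      also have "\<dots> = (\<Sum>x\<in>idx. d x * frob (n * r) (mono_op x v))"
        by (simp only: frob_sum frob_mult frob_frob n_le d_def)
      also have "\<dots> = comb d v"
        unfolding comb_def using mono_op_V[OF v] by (simp add: GF_def)
      finally show ?thesis by (simp add: comb_def)
    qed
    moreover have "d x \<in> V" for x using c(1) by (simp add: d_def GF_frob GF_diff)
    ultimately have "d x = 0" using comb_inj[of d "\<lambda>x. 0", OF _ _ _ x] by simp
    then show ?thesis by (simp add: d_def GF_def)
  qed
  moreover have "gcd (r * m) n = m"
  proof -
    obtain k where k: "n = m * k" using m_dvd by blast
    then have "coprime r k" using coprime_n_r by (simp add: coprime_commute)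
    then show ?thesis by (simp add: k mult.commute[of r] gcd_mult_distrib_nat[symmetric])
  qed
  ultimately have "x \<in> idx \<Longrightarrow> c x \<in> GF m" for x using GF_gcd[of "c x" "r * m" n] by simp
  then show ?thesis using c(2)
    by (intro exI[of _ "\<lambda>x. if x \<in> idx then c x else 0"]) (auto simp: comb_def)
qed

end

section \<open>Endomorphism rings and centralizers\<close>

lemma End_ring_simps:
  "f \<in> carrier (End_ring K M) \<longleftrightarrow> f \<in> carrier M \<rightarrow>\<^sub>E carrier M \<and>
     (\<forall>v\<in>carrier M. \<forall>w\<in>carrier M. f (v \<oplus>\<^bsub>M\<^esub> w) = f v \<oplus>\<^bsub>M\<^esub> f w) \<and>
     (\<forall>a\<in>carrier K. \<forall>v\<in>carrier M. f (a \<odot>\<^bsub>M\<^esub> v) = a \<odot>\<^bsub>M\<^esub> f v)"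
  "f \<otimes>\<^bsub>End_ring K M\<^esub> g = compose (carrier M) f g"
  "\<one>\<^bsub>End_ring K M\<^esub> = (\<lambda>v\<in>carrier M. v)"
  "\<zero>\<^bsub>End_ring K M\<^esub> = (\<lambda>v\<in>carrier M. \<zero>\<^bsub>M\<^esub>)"
  "f \<oplus>\<^bsub>End_ring K M\<^esub> g = (\<lambda>v\<in>carrier M. f v \<oplus>\<^bsub>M\<^esub> g v)"
  by (auto simp: End_ring_def)

lemma (in module) End_ring_eqI:
  "f \<in> carrier (End_ring R M) \<Longrightarrow> g \<in> carrier (End_ring R M) \<Longrightarrow>
     (\<And>v. v \<in> carrier M \<Longrightarrow> f v = g v) \<Longrightarrow> f = g"
  by (auto simp: End_ring_simps intro: PiE_ext)

lemma (in module) End_ring_ring: "ring (End_ring R M)"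
proof (rule ringI)
  let ?E = "End_ring R M"
  have closed: "f v \<in> carrier M" if "f \<in> carrier ?E" "v \<in> carrier M" for f v
    using that by (auto simp: End_ring_simps)
  have lin: "f (v \<oplus>\<^bsub>M\<^esub> w) = f v \<oplus>\<^bsub>M\<^esub> f w" if "f \<in> carrier ?E" "v \<in> carrier M" "w \<in> carrier M" for f v w
    using that by (auto simp: End_ring_simps)
  have smul: "f (a \<odot>\<^bsub>M\<^esub> v) = a \<odot>\<^bsub>M\<^esub> f v" if "f \<in> carrier ?E" "a \<in> carrier R" "v \<in> carrier M" for f a v
    using that by (auto simp: End_ring_simps)
  have add_closed: "f \<oplus>\<^bsub>?E\<^esub> g \<in> carrier ?E" if "f \<in> carrier ?E" "g \<in> carrier ?E" for f g
    unfolding End_ring_simps(1)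
    using that by (auto simp: End_ring_simps(5) closed lin smul smult_r_distr M.a_ac)
  have mult_closed: "f \<otimes>\<^bsub>?E\<^esub> g \<in> carrier ?E" if "f \<in> carrier ?E" "g \<in> carrier ?E" for f g
    unfolding End_ring_simps(1)
    using that by (auto simp: End_ring_simps(2) compose_def closed lin smul)
  have zero: "\<zero>\<^bsub>?E\<^esub> \<in> carrier ?E" and one: "\<one>\<^bsub>?E\<^esub> \<in> carrier ?E"
    by (auto simp: End_ring_simps)
  have neg: "(\<lambda>v\<in>carrier M. \<ominus>\<^bsub>M\<^esub> f v) \<in> carrier ?E" if "f \<in> carrier ?E" for f
    unfolding End_ring_simps(1)
    using that by (auto simp: closed lin smul M.minus_add smult_r_minus)
  show "abelian_group ?E"
  proof (rule abelian_groupI)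
    fix f assume f: "f \<in> carrier ?E"
    show "\<exists>g\<in>carrier ?E. g \<oplus>\<^bsub>?E\<^esub> f = \<zero>\<^bsub>?E\<^esub>"
      using neg[OF f] f by (intro bexI) (auto simp: End_ring_simps(4,5) closed M.l_neg intro!: restrict_ext)
    show "\<zero>\<^bsub>?E\<^esub> \<oplus>\<^bsub>?E\<^esub> f = f"
      by (rule End_ring_eqI) (auto simp: zero f add_closed, auto simp: End_ring_simps(4,5) closed f)
  next
    fix f g h assume fgh: "f \<in> carrier ?E" "g \<in> carrier ?E" "h \<in> carrier ?E"
    then show "f \<oplus>\<^bsub>?E\<^esub> g \<oplus>\<^bsub>?E\<^esub> h = f \<oplus>\<^bsub>?E\<^esub> (g \<oplus>\<^bsub>?E\<^esub> h)"
      by (auto simp: End_ring_simps(5) closed M.a_assoc intro!: restrict_ext)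
  next
    fix f g assume fgh: "f \<in> carrier ?E" "g \<in> carrier ?E"
    then show "f \<oplus>\<^bsub>?E\<^esub> g = g \<oplus>\<^bsub>?E\<^esub> f"
      by (auto simp: End_ring_simps(5) closed M.a_comm intro!: restrict_ext)
  qed (auto simp: zero add_closed)
  show "Group.monoid ?E"
  proof (rule monoidI)
    fix f g h assume fgh: "f \<in> carrier ?E" "g \<in> carrier ?E" "h \<in> carrier ?E"
    then show "f \<otimes>\<^bsub>?E\<^esub> g \<otimes>\<^bsub>?E\<^esub> h = f \<otimes>\<^bsub>?E\<^esub> (g \<otimes>\<^bsub>?E\<^esub> h)"
      by (auto simp: End_ring_simps(2) compose_def closed intro!: restrict_ext)
  next
    fix f assume f: "f \<in> carrier ?E"
    show "\<one>\<^bsub>?E\<^esub> \<otimes>\<^bsub>?E\<^esub> f = f" "f \<otimes>\<^bsub>?E\<^esub> \<one>\<^bsub>?E\<^esub> = f"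
      using f by (auto simp: End_ring_simps compose_def PiE_iff extensional_def fun_eq_iff)
  qed (auto simp: one mult_closed)
next
  let ?E = "End_ring R M"
  fix f g h assume "f \<in> carrier ?E" "g \<in> carrier ?E" "h \<in> carrier ?E"
  then show "(f \<oplus>\<^bsub>?E\<^esub> g) \<otimes>\<^bsub>?E\<^esub> h = f \<otimes>\<^bsub>?E\<^esub> h \<oplus>\<^bsub>?E\<^esub> g \<otimes>\<^bsub>?E\<^esub> h"
    "h \<otimes>\<^bsub>?E\<^esub> (f \<oplus>\<^bsub>?E\<^esub> g) = h \<otimes>\<^bsub>?E\<^esub> f \<oplus>\<^bsub>?E\<^esub> h \<otimes>\<^bsub>?E\<^esub> g"
    by (auto simp: End_ring_simps compose_def PiE_iff intro!: restrict_ext)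
qed

lemma (in ring) commute_generate_ring:
  assumes f: "f \<in> carrier R" and H: "H \<subseteq> carrier R"
    and comm: "\<And>g. g \<in> H \<Longrightarrow> f \<otimes> g = g \<otimes> f"
    and g: "g \<in> generate_ring R H"
  shows "f \<otimes> g = g \<otimes> f"
  using g
proof (induction rule: generate_ring.induct)
  case (a_inv h)
  then show ?case using f generate_ring_in_carrier[OF H] by (simp add: r_minus l_minus)
next
  case (eng_add h1 h2)
  then show ?case using f generate_ring_in_carrier[OF H] by (simp add: l_distr r_distr)
next
  case (eng_mult h1 h2)
  then show ?case using f generate_ring_in_carrier[OF H]
    by (metis m_assoc)
qed (use f comm in auto)

lemma centralizer_ring_ring:
  assumes "ring E" "Z \<subseteq> carrier E"
  shows "ring (centralizer_ring E Z)"
proof -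
  interpret ring E by fact
  have "subring {f \<in> carrier E. \<forall>g\<in>Z. f \<otimes>\<^bsub>E\<^esub> g = g \<otimes>\<^bsub>E\<^esub> f} E"
    using assms(2)
    by (intro subringI) (auto simp: subset_iff l_minus r_minus l_distr r_distr, metis m_assoc)
  then show ?thesis unfolding centralizer_ring_def by (rule subring_is_ring)
qed

section \<open>Tensor products with a free algebra\<close>

lemma monoid_ring_simps:
  "carrier (monoid_ring G) = {x. Poly_Mapping.keys x \<subseteq> carrier G}"
  "\<one>\<^bsub>monoid_ring G\<^esub> = frag_of \<one>\<^bsub>G\<^esub>"
  "\<zero>\<^bsub>monoid_ring G\<^esub> = 0"
  "x \<oplus>\<^bsub>monoid_ring G\<^esub> y = x + y"
  by (auto simp: monoid_ring_def)

lemma frag_extend_diff_fun: "frag_extend (\<lambda>a. f a - g a) x = frag_extend f x - frag_extend g x"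
  by (induction x rule: frag_induction[OF order_refl]) (auto simp: frag_extend_diff)

lemma monoid_ring_mult_of: "frag_of a \<otimes>\<^bsub>monoid_ring G\<^esub> frag_of b = frag_of (a \<otimes>\<^bsub>G\<^esub> b)"
  by (simp add: monoid_ring_def)

lemma monoid_ring_mult_diff:
  "(x - y) \<otimes>\<^bsub>monoid_ring G\<^esub> z = x \<otimes>\<^bsub>monoid_ring G\<^esub> z - y \<otimes>\<^bsub>monoid_ring G\<^esub> z"
  "z \<otimes>\<^bsub>monoid_ring G\<^esub> (x - y) = z \<otimes>\<^bsub>monoid_ring G\<^esub> x - z \<otimes>\<^bsub>monoid_ring G\<^esub> y"
  by (simp_all add: monoid_ring_def frag_extend_diff frag_extend_diff_fun)

lemma monoid_ring_mult_0:
  "0 \<otimes>\<^bsub>monoid_ring G\<^esub> z = 0" "z \<otimes>\<^bsub>monoid_ring G\<^esub> 0 = 0"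
  by (simp_all add: monoid_ring_def frag_extend_eq_0)

lemma monoid_ring_mult_add:
  "(x + y) \<otimes>\<^bsub>monoid_ring G\<^esub> z = x \<otimes>\<^bsub>monoid_ring G\<^esub> z + y \<otimes>\<^bsub>monoid_ring G\<^esub> z"
  "z \<otimes>\<^bsub>monoid_ring G\<^esub> (x + y) = z \<otimes>\<^bsub>monoid_ring G\<^esub> x + z \<otimes>\<^bsub>monoid_ring G\<^esub> y"
  using monoid_ring_mult_diff[where x=x and y="0 - y" and z=z and G=G]
    monoid_ring_mult_diff[where x=0 and y=y and z=z and G=G]
  by (simp_all add: monoid_ring_mult_0)

lemma monoid_ring_ring:
  assumes "Group.monoid G"
  shows "ring (monoid_ring G)"
proof (rule ringI)
  interpret monoid G by fact
  let ?Z = "monoid_ring G"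
  have closed: "x \<otimes>\<^bsub>?Z\<^esub> y \<in> carrier ?Z" if xy: "x \<in> carrier ?Z" "y \<in> carrier ?Z" for x y
  proof -
    have "Poly_Mapping.keys (x \<otimes>\<^bsub>?Z\<^esub> y) \<subseteq>
      (\<Union>a\<in>Poly_Mapping.keys x. \<Union>b\<in>Poly_Mapping.keys y. {a \<otimes>\<^bsub>G\<^esub> b})"
      unfolding monoid_ring_def monoid.simps
      by (intro order_trans[OF keys_frag_extend] UN_mono order_refl) (simp add: keys_frag_of)
    then show ?thesis using xy by (fastforce simp: monoid_ring_simps)
  qed
  show "abelian_group ?Z"
  proof (rule abelian_groupI)
    fix x assume "x \<in> carrier ?Z"
    then show "\<exists>y\<in>carrier ?Z. y \<oplus>\<^bsub>?Z\<^esub> x = \<zero>\<^bsub>?Z\<^esub>"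
      by (intro bexI[of _ "- x"]) (auto simp: monoid_ring_simps)
  qed (auto simp: monoid_ring_simps add_ac dest!: subsetD[OF keys_add])
  show "Group.monoid ?Z"
  proof (rule monoidI)
    fix x y z assume xyz: "x \<in> carrier ?Z" "y \<in> carrier ?Z" "z \<in> carrier ?Z"
    have 1: "x \<otimes>\<^bsub>?Z\<^esub> frag_of b \<otimes>\<^bsub>?Z\<^esub> frag_of c = x \<otimes>\<^bsub>?Z\<^esub> (frag_of b \<otimes>\<^bsub>?Z\<^esub> frag_of c)"
      if "b \<in> carrier G" "c \<in> carrier G" for b c
      using xyz(1) unfolding monoid_ring_simps mem_Collect_eq using that
      by (induction x rule: frag_induction)
        (auto simp: monoid_ring_mult_of monoid_ring_mult_diff monoid_ring_mult_0 m_assoc)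
    have 2: "x \<otimes>\<^bsub>?Z\<^esub> y \<otimes>\<^bsub>?Z\<^esub> frag_of c = x \<otimes>\<^bsub>?Z\<^esub> (y \<otimes>\<^bsub>?Z\<^esub> frag_of c)"
      if "c \<in> carrier G" for c
      using xyz(2) unfolding monoid_ring_simps mem_Collect_eq using that
      by (induction y rule: frag_induction)
        (auto simp: 1 monoid_ring_mult_diff monoid_ring_mult_0)
    show "x \<otimes>\<^bsub>?Z\<^esub> y \<otimes>\<^bsub>?Z\<^esub> z = x \<otimes>\<^bsub>?Z\<^esub> (y \<otimes>\<^bsub>?Z\<^esub> z)"
      using xyz(3) unfolding monoid_ring_simps mem_Collect_eq
      by (induction z rule: frag_induction)
        (auto simp: 2 monoid_ring_mult_diff monoid_ring_mult_0)
  next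
    fix x assume x: "x \<in> carrier ?Z"
    show "\<one>\<^bsub>?Z\<^esub> \<otimes>\<^bsub>?Z\<^esub> x = x" "x \<otimes>\<^bsub>?Z\<^esub> \<one>\<^bsub>?Z\<^esub> = x"
      using x unfolding monoid_ring_simps mem_Collect_eq
      by (induction x rule: frag_induction;
          simp add: monoid_ring_mult_of monoid_ring_mult_diff monoid_ring_mult_0)+
  qed (auto simp: closed, simp add: monoid_ring_simps keys_frag_of)
qed (simp_all add: monoid_ring_mult_add monoid_ring_simps(4))

lemma (in ring) monoid_ring_universal:
  assumes G: "Group.monoid G" and g: "g \<in> carrier G \<rightarrow> carrier R"
    and mult: "\<And>x y. x \<in> carrier G \<Longrightarrow> y \<in> carrier G \<Longrightarrow> g (x \<otimes>\<^bsub>G\<^esub> y) = g x \<otimes> g y"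
    and one: "g \<one>\<^bsub>G\<^esub> = \<one>"
  obtains h where "h \<in> ring_hom (monoid_ring G) R" "\<And>x. x \<in> carrier G \<Longrightarrow> h (frag_of x) = g x"
proof -
  let ?Z = "monoid_ring G"
  interpret G: monoid G by fact
  have "g ` carrier G \<subseteq> carrier (add_monoid R)" using g by auto
  then obtain h where h: "h \<in> hom (free_Abelian_group (carrier G)) (add_monoid R)"
    and of: "\<And>x. x \<in> carrier G \<Longrightarrow> h (frag_of x) = g x"
    using comm_group.free_Abelian_group_universal[OF a_comm_group] by blast
  have closed: "h x \<in> carrier R" if "x \<in> carrier ?Z" for x
    using h that by (auto simp: hom_def monoid_ring_simps)
  have add: "h (x + y) = h x \<oplus> h y" if "x \<in> carrier ?Z" "y \<in> carrier ?Z" for x y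
    using h that by (auto simp: hom_def monoid_ring_simps)
  interpret Z: ring ?Z by (rule monoid_ring_ring[OF G])
  have diff_closed: "x - y \<in> carrier ?Z" if "x \<in> carrier ?Z" "y \<in> carrier ?Z" for x y
    using that keys_diff[of x y] by (auto simp: monoid_ring_simps)
  have h_diff: "h (x - y) = h x \<ominus> h y" if xy: "x \<in> carrier ?Z" "y \<in> carrier ?Z" for x y
    using add[OF diff_closed[OF xy] xy(2)] closed[OF diff_closed[OF xy]] closed xy
    by (simp add: minus_eq a_assoc r_neg)
  have h_zero: "h 0 = \<zero>"
    using h_diff[of 0 0] closed[of 0] by (simp add: monoid_ring_simps r_neg minus_eq)
  have h_mult: "h (x \<otimes>\<^bsub>?Z\<^esub> y) = h x \<otimes> h y" if xy: "x \<in> carrier ?Z" "y \<in> carrier ?Z" for x y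
  proof -
    have *: "x \<in> carrier ?Z \<and> h (x \<otimes>\<^bsub>?Z\<^esub> frag_of b) = h x \<otimes> h (frag_of b)" if b: "b \<in> carrier G" for b
      using xy(1) unfolding monoid_ring_simps(1) mem_Collect_eq
    proof (induction x rule: frag_induction)
      case zero
      then show ?case using b g by (simp add: monoid_ring_mult_0 h_zero of Pi_iff)
    next
      case (one a)
      then show ?case using b by (simp add: monoid_ring_mult_of of mult keys_frag_of)
    next
      case (diff a c)
      have b': "frag_of b \<in> carrier ?Z" using b by (simp add: monoid_ring_simps keys_frag_of)
      have ac: "a \<in> carrier ?Z" "c \<in> carrier ?Z" using diff by (auto simp: monoid_ring_simps)
      then have "a - c \<in> carrier ?Z" by (rule diff_closed)
      moreover have "h ((a - c) \<otimes>\<^bsub>?Z\<^esub> frag_of b) = h (a - c) \<otimes> h (frag_of b)"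
        using diff ac b' closed
        by (simp add: monoid_ring_mult_diff h_diff minus_eq l_distr l_minus)
      ultimately show ?case by (auto simp: monoid_ring_simps(1))
    qed
    have "y \<in> carrier ?Z \<and> h (x \<otimes>\<^bsub>?Z\<^esub> y) = h x \<otimes> h y"
      using xy(2) unfolding monoid_ring_simps(1) mem_Collect_eq
    proof (induction y rule: frag_induction)
      case zero
      then show ?case using closed[OF xy(1)] by (simp add: monoid_ring_mult_0 h_zero)
    next
      case (one a)
      then show ?case using * by (simp add: keys_frag_of)
    next
      case (diff a c)
      have ac: "a \<in> carrier ?Z" "c \<in> carrier ?Z" using diff by (auto simp: monoid_ring_simps)
      then have "a - c \<in> carrier ?Z" by (rule diff_closed)
      moreover have "h (x \<otimes>\<^bsub>?Z\<^esub> (a - c)) = h x \<otimes> h (a - c)"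
        using diff ac xy closed
        by (simp add: monoid_ring_mult_diff h_diff minus_eq r_distr r_minus)
      ultimately show ?case by (auto simp: monoid_ring_simps(1))
    qed
    then show ?thesis ..
  qed
  have "h \<in> ring_hom ?Z R"
    using closed add h_mult of[OF G.one_closed] one
    by (intro ring_hom_memI) (auto simp: monoid_ring_simps(2,4))
  then show thesis using of that by blast
qed

text \<open>
  If \<open>A\<close> is spanned over \<open>k\<close> by the \<open>e i\<close>, every tensor can be written \<open>\<Sum>i. e i \<otimes> b i\<close>. A
  homomorphism that is injective on such expressions is therefore injective.
\<close>

lemma tensor_ring_iso_of_basis:
  fixes A :: "'a ring" and B :: "'b ring" and S :: "'c ring" and e :: "'i \<Rightarrow> 'a"
  assumes A: "ring A" and B: "ring B" and S: "ring S"
    and u: "u \<in> ring_hom A S" and w: "w \<in> ring_hom B S"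
    and comm: "\<And>a b. a \<in> carrier A \<Longrightarrow> b \<in> carrier B \<Longrightarrow> u a \<otimes>\<^bsub>S\<^esub> w b = w b \<otimes>\<^bsub>S\<^esub> u a"
    and \<iota>: "\<And>c. \<iota> c \<in> carrier A" "\<And>c. \<iota>' c \<in> carrier B"
    and bal: "\<And>c. u (\<iota> c) = w (\<iota>' c)"
    and I: "finite I" and e: "\<And>i. i \<in> I \<Longrightarrow> e i \<in> carrier A"
    and span: "\<And>a. a \<in> carrier A \<Longrightarrow> \<exists>c. a = (\<Oplus>\<^bsub>A\<^esub>i\<in>I. e i \<otimes>\<^bsub>A\<^esub> \<iota> (c i))"
    and surj: "\<And>s. s \<in> carrier S \<Longrightarrow>
      \<exists>b\<in>I \<rightarrow> carrier B. s = (\<Oplus>\<^bsub>S\<^esub>i\<in>I. u (e i) \<otimes>\<^bsub>S\<^esub> w (b i))"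
    and indep: "\<And>b i. b \<in> I \<rightarrow> carrier B \<Longrightarrow>
      (\<Oplus>\<^bsub>S\<^esub>i\<in>I. u (e i) \<otimes>\<^bsub>S\<^esub> w (b i)) = \<zero>\<^bsub>S\<^esub> \<Longrightarrow> i \<in> I \<Longrightarrow> b i = \<zero>\<^bsub>B\<^esub>"
  shows "\<exists>\<mu>\<in>ring_iso (tensor_ring \<iota> \<iota>' A B) S. \<forall>a\<in>carrier A. \<forall>b\<in>carrier B.
           \<mu> (pure_tensor \<iota> \<iota>' A B a b) = u a \<otimes>\<^bsub>S\<^esub> w b"
proof -
  interpret A: ring A by fact
  interpret B: ring B by fact
  interpret S: ring S by fact
  interpret u: ring_hom_ring A S u by (rule ring_hom_ringI2[OF A S u])
  interpret w: ring_hom_ring B S w by (rule ring_hom_ringI2[OF B S w])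
  let ?G = "A \<times>\<times> B"
  let ?Z = "monoid_ring ?G"
  let ?rel = "tensor_relations \<iota> \<iota>' A B"
  have G: "Group.monoid ?G" by (rule DirProd_monoid) (rule A.monoid_axioms B.monoid_axioms)+
  interpret Z: ring ?Z by (rule monoid_ring_ring[OF G])
  obtain h where h: "h \<in> ring_hom ?Z S"
    and h_of: "\<And>a b. a \<in> carrier A \<Longrightarrow> b \<in> carrier B \<Longrightarrow> h (frag_of (a, b)) = u a \<otimes>\<^bsub>S\<^esub> w b"
  proof (rule S.monoid_ring_universal[OF G, of "\<lambda>(a, b). u a \<otimes>\<^bsub>S\<^esub> w b"])
    fix x y assume "x \<in> carrier ?G" "y \<in> carrier ?G"
    then obtain a b a' b' where xy: "x = (a, b)" "y = (a', b')"
      and ab: "a \<in> carrier A" "a' \<in> carrier A" "b \<in> carrier B" "b' \<in> carrier B" by auto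
    have "u a \<otimes>\<^bsub>S\<^esub> u a' \<otimes>\<^bsub>S\<^esub> (w b \<otimes>\<^bsub>S\<^esub> w b') = u a \<otimes>\<^bsub>S\<^esub> (u a' \<otimes>\<^bsub>S\<^esub> w b) \<otimes>\<^bsub>S\<^esub> w b'"
      using ab by (simp add: S.m_assoc)
    also have "\<dots> = u a \<otimes>\<^bsub>S\<^esub> w b \<otimes>\<^bsub>S\<^esub> (u a' \<otimes>\<^bsub>S\<^esub> w b')"
      using ab comm[of a' b] by (simp add: S.m_assoc)
    finally show "(case x \<otimes>\<^bsub>?G\<^esub> y of (a, b) \<Rightarrow> u a \<otimes>\<^bsub>S\<^esub> w b) =
        (case x of (a, b) \<Rightarrow> u a \<otimes>\<^bsub>S\<^esub> w b) \<otimes>\<^bsub>S\<^esub> (case y of (a, b) \<Rightarrow> u a \<otimes>\<^bsub>S\<^esub> w b)"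
      using ab by (simp add: xy)
  next
    fix h' assume "h' \<in> ring_hom ?Z S"
      "\<And>x. x \<in> carrier ?G \<Longrightarrow> h' (frag_of x) = (case x of (a, b) \<Rightarrow> u a \<otimes>\<^bsub>S\<^esub> w b)"
    then show thesis using that[of h'] by auto
  qed auto
  interpret h: ring_hom_ring ?Z S h by (rule ring_hom_ringI2[OF Z.ring_axioms S h])
  have of_Z: "frag_of (a, b) \<in> carrier ?Z" if "a \<in> carrier A" "b \<in> carrier B" for a b
    using that by (simp add: monoid_ring_simps keys_frag_of)
  have Z_add: "x + y \<in> carrier ?Z" and h_add: "h (x + y) = h x \<oplus>\<^bsub>S\<^esub> h y"
    if "x \<in> carrier ?Z" "y \<in> carrier ?Z" for x y
    using that Z.a_closed[of x y] h.hom_add[of x y] by (simp_all add: monoid_ring_simps(4))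
  have Z_minus: "a_inv ?Z x = - x" if "x \<in> carrier ?Z" for x
    using that by (intro Z.minus_equality) (auto simp: monoid_ring_simps)
  have Z_diff: "x - y \<in> carrier ?Z" and h_diff: "h (x - y) = h x \<ominus>\<^bsub>S\<^esub> h y"
    if "x \<in> carrier ?Z" "y \<in> carrier ?Z" for x y
  proof -
    have neg: "- y \<in> carrier ?Z" "h (- y) = \<ominus>\<^bsub>S\<^esub> h y"
      using that Z.a_inv_closed[of y] h.hom_a_inv[of y] by (simp_all add: Z_minus)
    show "x - y \<in> carrier ?Z" "h (x - y) = h x \<ominus>\<^bsub>S\<^esub> h y"
      using Z_add[OF that(1) neg(1)] h_add[OF that(1) neg(1)] neg by (simp_all add: S.minus_eq)
  qed
  have h_0: "h 0 = \<zero>\<^bsub>S\<^esub>" using h.hom_zero by (simp add: monoid_ring_simps(3))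
  have rel: "?rel \<subseteq> carrier ?Z"
    unfolding tensor_relations_def using \<iota> by (auto intro!: Z_diff of_Z)
  define J where "J = tensor_ideal \<iota> \<iota>' A B"
  interpret J: ideal J ?Z unfolding J_def tensor_ideal_def by (rule Z.genideal_ideal[OF rel])
  have rel_J: "x \<in> J" if "x \<in> ?rel" for x
    using Z.genideal_self[OF rel] that unfolding J_def tensor_ideal_def by blast
  have J_diff: "x - y \<in> J" if "x \<in> J" "y \<in> J" for x y
    using J.a_closed[OF that(1) J.a_inv_closed[OF that(2)]] J.Icarr[OF that(2)]
    by (simp add: monoid_ring_simps(4) Z_minus)
  have J_0: "0 \<in> J" using J.zero_closed by (simp add: monoid_ring_simps(3))
  have J_add: "x + y \<in> J" if "x \<in> J" "y \<in> J" for x y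
    using J.a_closed[OF that] by (simp add: monoid_ring_simps(4))
  have J_sum: "sum f K \<in> J" if "\<And>k. k \<in> K \<Longrightarrow> f k \<in> J" for f and K :: "'i set"
    using that by (induction K rule: infinite_finite_induct) (auto simp: J_0 J_add)
  have J_addl: "frag_of (a \<oplus>\<^bsub>A\<^esub> a', b) - frag_of (a, b) - frag_of (a', b) \<in> J"
    if "a \<in> carrier A" "a' \<in> carrier A" "b \<in> carrier B" for a a' b
    using that by (intro rel_J) (auto simp: tensor_relations_def)
  have J_addr: "frag_of (a, b \<oplus>\<^bsub>B\<^esub> b') - frag_of (a, b) - frag_of (a, b') \<in> J"
    if "a \<in> carrier A" "b \<in> carrier B" "b' \<in> carrier B" for a b b'
    using that by (intro rel_J) (auto simp: tensor_relations_def)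
  have J_bal: "frag_of (a \<otimes>\<^bsub>A\<^esub> \<iota> c, b) - frag_of (a, \<iota>' c \<otimes>\<^bsub>B\<^esub> b) \<in> J"
    if "a \<in> carrier A" "b \<in> carrier B" for a b c
    using that by (intro rel_J) (auto simp: tensor_relations_def)
  have J_0l: "frag_of (\<zero>\<^bsub>A\<^esub>, b) \<in> J" if "b \<in> carrier B" for b
    using J_diff[OF J_0 J_addl[of "\<zero>\<^bsub>A\<^esub>" "\<zero>\<^bsub>A\<^esub>" b]] that by simp
  have J_0r: "frag_of (a, \<zero>\<^bsub>B\<^esub>) \<in> J" if "a \<in> carrier A" for a
    using J_diff[OF J_0 J_addr[of a "\<zero>\<^bsub>B\<^esub>" "\<zero>\<^bsub>B\<^esub>"]] that by simp
  have J_finsum: "frag_of (\<Oplus>\<^bsub>A\<^esub>i\<in>K. x i, b) - (\<Sum>i\<in>K. frag_of (x i, b)) \<in> J"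
    if "finite K" "x \<in> K \<rightarrow> carrier A" "b \<in> carrier B" for K :: "'i set" and x b
    using that
  proof (induction K rule: finite_induct)
    case empty
    then show ?case by (simp add: J_0l)
  next
    case (insert k K)
    then have x: "x \<in> K \<rightarrow> carrier A" "x k \<in> carrier A" by auto
    have "frag_of (\<Oplus>\<^bsub>A\<^esub>i\<in>insert k K. x i, b) - (\<Sum>i\<in>insert k K. frag_of (x i, b)) =
      (frag_of (x k \<oplus>\<^bsub>A\<^esub> (\<Oplus>\<^bsub>A\<^esub>i\<in>K. x i), b) - frag_of (x k, b) - frag_of (\<Oplus>\<^bsub>A\<^esub>i\<in>K. x i, b))
      + (frag_of (\<Oplus>\<^bsub>A\<^esub>i\<in>K. x i, b) - (\<Sum>i\<in>K. frag_of (x i, b)))"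
      using insert x by (simp add: A.finsum_insert)
    then show ?case using insert x by (simp only: J_add J_addl A.finsum_closed)
  qed
  define N where "N b = (\<Sum>i\<in>I. frag_of (e i, b i))" for b :: "'i \<Rightarrow> 'b"
  have normal_form: "\<exists>b\<in>I \<rightarrow> carrier B. x - N b \<in> J" if "Poly_Mapping.keys x \<subseteq> carrier ?G" for x
    using that
  proof (induction x rule: frag_induction)
    case zero
    have "N (\<lambda>i. \<zero>\<^bsub>B\<^esub>) \<in> J" unfolding N_def by (intro J_sum J_0r e)
    then show ?case by (intro bexI[of _ "\<lambda>i. \<zero>\<^bsub>B\<^esub>"] J_diff J_0) auto
  next
    case (one x)
    then obtain a b where x: "x = (a, b)" and ab: "a \<in> carrier A" "b \<in> carrier B" by auto
    obtain c where c: "a = (\<Oplus>\<^bsub>A\<^esub>i\<in>I. e i \<otimes>\<^bsub>A\<^esub> \<iota> (c i))" using span[OF ab(1)] by blast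
    have "(\<Sum>i\<in>I. frag_of (e i \<otimes>\<^bsub>A\<^esub> \<iota> (c i), b)) - N (\<lambda>i. \<iota>' (c i) \<otimes>\<^bsub>B\<^esub> b) \<in> J"
      unfolding N_def sum_subtractf[symmetric] using ab e by (intro J_sum J_bal) auto
    moreover have "frag_of x - (\<Sum>i\<in>I. frag_of (e i \<otimes>\<^bsub>A\<^esub> \<iota> (c i), b)) \<in> J"
      unfolding x c using ab e \<iota> by (intro J_finsum I) auto
    ultimately have "frag_of x - N (\<lambda>i. \<iota>' (c i) \<otimes>\<^bsub>B\<^esub> b) \<in> J"
      using J_add by fastforce
    moreover have "(\<lambda>i. \<iota>' (c i) \<otimes>\<^bsub>B\<^esub> b) \<in> I \<rightarrow> carrier B" using ab \<iota> by auto
    ultimately show ?case by blast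
  next
    case (diff x y)
    then obtain b b' where b: "b \<in> I \<rightarrow> carrier B" "x - N b \<in> J"
      and b': "b' \<in> I \<rightarrow> carrier B" "y - N b' \<in> J" by blast
    let ?d = "\<lambda>i. b i \<ominus>\<^bsub>B\<^esub> b' i"
    have "frag_of (e i, b i) - frag_of (e i, ?d i) - frag_of (e i, b' i) \<in> J" if i: "i \<in> I" for i
    proof -
      have "b i = ?d i \<oplus>\<^bsub>B\<^esub> b' i" using b b' i
        by (simp add: Pi_iff B.minus_eq B.a_assoc B.l_neg)
      then show ?thesis using J_addr[of "e i" "?d i" "b' i"] b b' i e by (simp add: Pi_iff)
    qed
    then have "N b - N ?d - N b' \<in> J"
      unfolding N_def sum_subtractf[symmetric] by (rule J_sum)
    from J_add[OF J_diff[OF b(2) b'(2)] this]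
    have "(x - N b) - (y - N b') + (N b - N ?d - N b') \<in> J" .
    then have "x - y - N ?d \<in> J" by (simp add: algebra_simps)
    moreover have "?d \<in> I \<rightarrow> carrier B" using b b' by (auto simp: Pi_iff)
    ultimately show ?case by blast
  qed
  have N_Z: "N b \<in> carrier ?Z \<and> h (N b) = (\<Oplus>\<^bsub>S\<^esub>i\<in>I. u (e i) \<otimes>\<^bsub>S\<^esub> w (b i))"
    if "b \<in> I \<rightarrow> carrier B" for b
    unfolding N_def using I that e
  proof (induction I rule: finite_induct)
    case empty
    then show ?case by (simp add: monoid_ring_simps h_0[simplified])
  next
    case (insert i I)
    then have i: "e i \<in> carrier A" "b i \<in> carrier B" by auto
    have cl: "(\<lambda>i. u (e i) \<otimes>\<^bsub>S\<^esub> w (b i)) \<in> I \<rightarrow> carrier S"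
      using insert.prems by (auto simp: Pi_iff)
    show ?case
      using insert i cl by (simp add: Z_add h_add of_Z h_of S.finsum_insert)
  qed
  have kernel: "a_kernel ?Z S h = J"
  proof
    have cancel: "x \<oplus>\<^bsub>S\<^esub> (y \<oplus>\<^bsub>S\<^esub> (\<ominus>\<^bsub>S\<^esub> x \<oplus>\<^bsub>S\<^esub> \<ominus>\<^bsub>S\<^esub> y)) = \<zero>\<^bsub>S\<^esub>"
      if "x \<in> carrier S" "y \<in> carrier S" for x y
      using S.r_neg[of "x \<oplus>\<^bsub>S\<^esub> y"] that by (simp add: S.minus_add S.a_assoc)
    have "h (frag_of (a \<oplus>\<^bsub>A\<^esub> a', b) - frag_of (a, b) - frag_of (a', b)) = \<zero>\<^bsub>S\<^esub>"
      if "a \<in> carrier A" "a' \<in> carrier A" "b \<in> carrier B" for a a' b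
      using that by (simp add: h_diff Z_diff of_Z h_of S.l_distr S.minus_eq S.a_assoc cancel)
    moreover have "h (frag_of (a, b \<oplus>\<^bsub>B\<^esub> b') - frag_of (a, b) - frag_of (a, b')) = \<zero>\<^bsub>S\<^esub>"
      if "a \<in> carrier A" "b \<in> carrier B" "b' \<in> carrier B" for a b b'
      using that by (simp add: h_diff Z_diff of_Z h_of S.r_distr S.minus_eq S.a_assoc cancel)
    moreover have "h (frag_of (a \<otimes>\<^bsub>A\<^esub> \<iota> c, b) - frag_of (a, \<iota>' c \<otimes>\<^bsub>B\<^esub> b)) = \<zero>\<^bsub>S\<^esub>"
      if "a \<in> carrier A" "b \<in> carrier B" for a b c
      using that \<iota> bal w.hom_closed[OF \<iota>(2)]
      by (simp add: h_diff of_Z h_of S.minus_eq S.m_assoc S.r_neg)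
    ultimately have h_rel: "h x = \<zero>\<^bsub>S\<^esub>" if "x \<in> ?rel" for x
      using that unfolding tensor_relations_def by (elim UnE CollectE exE conjE) simp_all
    have "?rel \<subseteq> a_kernel ?Z S h"
      unfolding a_kernel_def' by (intro subsetI CollectI conjI subsetD[OF rel] h_rel)
    then show "J \<subseteq> a_kernel ?Z S h"
      unfolding J_def tensor_ideal_def by (rule Z.genideal_minimal[OF h.kernel_is_ideal])
    show "a_kernel ?Z S h \<subseteq> J"
    proof
      fix x assume "x \<in> a_kernel ?Z S h"
      then have x: "x \<in> carrier ?Z" "h x = \<zero>\<^bsub>S\<^esub>"
        by (simp_all only: a_kernel_def' mem_Collect_eq)
      then have "\<exists>b\<in>I \<rightarrow> carrier B. x - N b \<in> J"
        by (intro normal_form) (simp only: monoid_ring_simps mem_Collect_eq)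
      then obtain b where b: "b \<in> I \<rightarrow> carrier B" "x - N b \<in> J" ..
      have "h (x - N b) = \<zero>\<^bsub>S\<^esub>"
        using subsetD[OF \<open>J \<subseteq> a_kernel ?Z S h\<close> b(2)] by (simp only: a_kernel_def' mem_Collect_eq)
      then have "h (N b) = \<zero>\<^bsub>S\<^esub>"
        using N_Z[OF b(1)] x h_diff[OF x(1), of "N b"] h.hom_closed[of "N b"]
        by (simp add: S.minus_eq)
      then have z: "(\<Oplus>\<^bsub>S\<^esub>i\<in>I. u (e i) \<otimes>\<^bsub>S\<^esub> w (b i)) = \<zero>\<^bsub>S\<^esub>" using N_Z[OF b(1)] by simp
      have "i \<in> I \<Longrightarrow> b i = \<zero>\<^bsub>B\<^esub>" for i by (rule indep[OF b(1) z])
      then have "N b \<in> J" unfolding N_def by (intro J_sum) (simp add: J_0r e)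
      from J_add[OF b(2) this] show "x \<in> J" by simp
    qed
  qed
  have "h ` carrier ?Z = carrier S"
  proof
    show "carrier S \<subseteq> h ` carrier ?Z"
    proof
      fix s assume "s \<in> carrier S"
      then obtain b where b: "b \<in> I \<rightarrow> carrier B" "s = (\<Oplus>\<^bsub>S\<^esub>i\<in>I. u (e i) \<otimes>\<^bsub>S\<^esub> w (b i))"
        using surj by blast
      show "s \<in> h ` carrier ?Z"
        by (rule image_eqI[of _ _ "N b"]) (simp_all only: b(2) N_Z[OF b(1)])
    qed
    show "h ` carrier ?Z \<subseteq> carrier S" by (rule image_subsetI) (rule h.hom_closed)
  qed
  then have "(\<lambda>C. the_elem (h ` C)) \<in> ring_iso (?Z Quot a_kernel ?Z S h) S"
    by (rule h.FactRing_iso_set)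
  then have "(\<lambda>C. the_elem (h ` C)) \<in> ring_iso (tensor_ring \<iota> \<iota>' A B) S"
    by (simp add: kernel tensor_ring_def J_def)
  moreover have "the_elem (h ` pure_tensor \<iota> \<iota>' A B a b) = u a \<otimes>\<^bsub>S\<^esub> w b"
    if "a \<in> carrier A" "b \<in> carrier B" for a b
    using h.the_elem_simp[OF of_Z[OF that]] that
    by (simp add: kernel pure_tensor_def J_def[symmetric] h_of)
  ultimately show ?thesis by (intro bexI[of _ "\<lambda>C. the_elem (h ` C)"]) auto
qed

section \<open>Transport of left ideals and of bases\<close>

lemma left_ideal_image:
  assumes A: "ring A" and S: "ring S" and f: "f \<in> ring_hom A S" "f ` carrier A = carrier S"
    and J: "left_ideal J A"
  shows "left_ideal (f ` J) S"
proof -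
  interpret f: ring_hom_ring A S f by (rule ring_hom_ringI2[OF A S f(1)])
  have J': "subgroup J (add_monoid A)" "\<And>a x. a \<in> carrier A \<Longrightarrow> x \<in> J \<Longrightarrow> a \<otimes>\<^bsub>A\<^esub> x \<in> J"
    using J by (auto simp: left_ideal_def additive_subgroup_def)
  have sub: "J \<subseteq> carrier A" using subgroup.subset[OF J'(1)] by simp
  have "additive_subgroup (f ` J) S"
    using f.img_is_add_subgroup[OF J'(1)] by (simp add: additive_subgroup_def)
  moreover have "a \<otimes>\<^bsub>S\<^esub> f x \<in> f ` J" if a: "a \<in> carrier S" and x: "x \<in> J" for a x
  proof -
    obtain a' where "a' \<in> carrier A" "a = f a'" using a f(2) by auto
    then show ?thesis using J'(2)[of a' x] x sub by (auto simp flip: f.hom_mult)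
  qed
  ultimately show ?thesis by (auto simp: left_ideal_def)
qed

lemma left_ideals_iso:
  assumes A: "ring A" and S: "ring S" and f: "f \<in> ring_iso A S"
  shows "{I. left_ideal I S} = (\<lambda>J. f ` J) ` {J. left_ideal J A}"
proof -
  have hom: "f \<in> ring_hom A S" and im: "f ` carrier A = carrier S" and inj: "inj_on f (carrier A)"
    using f by (auto simp: ring_iso_def bij_betw_def)
  let ?g = "inv_into (carrier A) f"
  have g: "?g \<in> ring_iso S A" by (rule ring_iso_set_sym[OF A f])
  have ghom: "?g \<in> ring_hom S A" and gim: "?g ` carrier S = carrier A"
    using g by (auto simp: ring_iso_def bij_betw_def)
  have "I = f ` ?g ` I" if "left_ideal I S" for I
  proof -
    have "I \<subseteq> f ` carrier A"
      using that subgroup.subset[of I "add_monoid S"] by (simp add: im left_ideal_def additive_subgroup_def)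
    then show ?thesis by (rule image_inv_into_cancel[OF refl, symmetric])
  qed
  then show ?thesis
    using left_ideal_image[OF A S hom im] left_ideal_image[OF S A ghom gim] by blast
qed

text \<open>Being a basis only depends on the additive group and on the scalar operators.\<close>

lemma basis_family_transport:
  fixes M :: "('k, 'v) module" and M' :: "('l, 'v) module"
  assumes ab: "abelian_group M" "abelian_group M'"
    and M: "carrier M' = carrier M" "add M' = add M" "\<zero>\<^bsub>M'\<^esub> = \<zero>\<^bsub>M\<^esub>"
    and \<psi>: "bij_betw \<psi> (carrier K') (carrier K)" "\<psi> \<zero>\<^bsub>K'\<^esub> = \<zero>\<^bsub>K\<^esub>" "\<zero>\<^bsub>K'\<^esub> \<in> carrier K'"
    and smult: "\<And>c v. c \<in> carrier K' \<Longrightarrow> v \<in> carrier M \<Longrightarrow> c \<odot>\<^bsub>M'\<^esub> v = \<psi> c \<odot>\<^bsub>M\<^esub> v"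
    and smult_closed: "\<And>c v. c \<in> carrier K \<Longrightarrow> v \<in> carrier M \<Longrightarrow> c \<odot>\<^bsub>M\<^esub> v \<in> carrier M"
  shows "basis_family K' M' n b \<longleftrightarrow> basis_family K M n b"
proof (cases "b \<in> {..<n} \<rightarrow> carrier M")
  case b: True
  interpret M: abelian_group M by fact
  interpret M': abelian_group M' by fact
  have \<psi>_closed: "\<psi> c \<in> carrier K" if "c \<in> carrier K'" for c
    using \<psi>(1) that by (auto simp: bij_betw_def)
  have finsum: "finsum M' f I = finsum M f I" if "finite I" "f \<in> I \<rightarrow> carrier M"
    for f :: "nat \<Rightarrow> 'v" and I
    using that
  proof (induction I rule: finite_induct)
    case (insert i I)
    then have "f \<in> I \<rightarrow> carrier M" "f i \<in> carrier M" by auto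
    then show ?case using insert by (simp add: M'.finsum_insert M.finsum_insert M)
  qed (simp add: M)
  define S where "S c = (\<Oplus>\<^bsub>M\<^esub>i\<in>{..<n}. c i \<odot>\<^bsub>M\<^esub> b i)" for c
  define S' where "S' c = (\<Oplus>\<^bsub>M'\<^esub>i\<in>{..<n}. c i \<odot>\<^bsub>M'\<^esub> b i)" for c
  have S_eq: "S' c = S d"
    if c: "c \<in> {..<n} \<rightarrow> carrier K'" and d: "\<And>i. i < n \<Longrightarrow> d i = \<psi> (c i)" for c d
  proof -
    have cl: "(\<lambda>i. d i \<odot>\<^bsub>M\<^esub> b i) \<in> {..<n} \<rightarrow> carrier M"
      using b c d by (auto simp: Pi_iff intro!: smult_closed \<psi>_closed)
    have "S' c = (\<Oplus>\<^bsub>M'\<^esub>i\<in>{..<n}. d i \<odot>\<^bsub>M\<^esub> b i)"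
      unfolding S'_def using cl b c d by (intro M'.finsum_cong') (auto simp: M smult Pi_iff)
    then show ?thesis using finsum[OF _ cl] by (simp add: S_def)
  qed
  have lift: "\<exists>c\<in>{..<n} \<rightarrow> carrier K'. \<forall>i<n. d i = \<psi> (c i)" if "d \<in> {..<n} \<rightarrow> carrier K" for d
    using that \<psi>(1)
    by (intro bexI[of _ "\<lambda>i. inv_into (carrier K') \<psi> (d i)"])
      (auto simp: bij_betw_def Pi_iff f_inv_into_f inv_into_into)
  have \<psi>_0: "\<psi> c = \<zero>\<^bsub>K\<^esub> \<longleftrightarrow> c = \<zero>\<^bsub>K'\<^esub>" if "c \<in> carrier K'" for c
    using \<psi> that by (metis bij_betw_def inj_onD)
  have "(\<forall>c\<in>{..<n} \<rightarrow> carrier K'. S' c = \<zero>\<^bsub>M\<^esub> \<longrightarrow> (\<forall>i<n. c i = \<zero>\<^bsub>K'\<^esub>)) \<longleftrightarrow>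
    (\<forall>d\<in>{..<n} \<rightarrow> carrier K. S d = \<zero>\<^bsub>M\<^esub> \<longrightarrow> (\<forall>i<n. d i = \<zero>\<^bsub>K\<^esub>))" (is "?l \<longleftrightarrow> ?r")
  proof
    assume l: ?l
    show ?r
    proof (intro ballI impI allI)
      fix d i assume d: "d \<in> {..<n} \<rightarrow> carrier K" "S d = \<zero>\<^bsub>M\<^esub>" "i < n"
      obtain c where c: "c \<in> {..<n} \<rightarrow> carrier K'" "\<forall>i<n. d i = \<psi> (c i)" using lift[OF d(1)] by blast
      then have "c i = \<zero>\<^bsub>K'\<^esub>" using l d S_eq[OF c(1), of d] by auto
      then show "d i = \<zero>\<^bsub>K\<^esub>" using c d \<psi> by simp
    qed
  next
    assume r: ?r
    show ?l
    proof (intro ballI impI allI)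
      fix c i assume c: "c \<in> {..<n} \<rightarrow> carrier K'" "S' c = \<zero>\<^bsub>M\<^esub>" "i < n"
      have "(\<lambda>i. \<psi> (c i)) \<in> {..<n} \<rightarrow> carrier K" using c \<psi>_closed by auto
      moreover have "S (\<lambda>i. \<psi> (c i)) = \<zero>\<^bsub>M\<^esub>" using S_eq[OF c(1), of "\<lambda>i. \<psi> (c i)"] c by simp
      ultimately have "\<psi> (c i) = \<zero>\<^bsub>K\<^esub>" using r c(3) by blast
      then show "c i = \<zero>\<^bsub>K'\<^esub>" using c \<psi>_0 by auto
    qed
  qed
  moreover have "(\<exists>c\<in>{..<n} \<rightarrow> carrier K'. v = S' c) \<longleftrightarrow> (\<exists>d\<in>{..<n} \<rightarrow> carrier K. v = S d)" for v
  proof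
    assume "\<exists>c\<in>{..<n} \<rightarrow> carrier K'. v = S' c"
    then obtain c where c: "c \<in> {..<n} \<rightarrow> carrier K'" "v = S' c" by blast
    then show "\<exists>d\<in>{..<n} \<rightarrow> carrier K. v = S d"
      using S_eq[OF c(1), of "\<lambda>i. \<psi> (c i)"] \<psi>_closed by (intro bexI[of _ "\<lambda>i. \<psi> (c i)"]) auto
  next
    assume "\<exists>d\<in>{..<n} \<rightarrow> carrier K. v = S d"
    then obtain d where d: "d \<in> {..<n} \<rightarrow> carrier K" "v = S d" by blast
    obtain c where c: "c \<in> {..<n} \<rightarrow> carrier K'" "\<forall>i<n. d i = \<psi> (c i)" using lift[OF d(1)] by blast
    then show "\<exists>c\<in>{..<n} \<rightarrow> carrier K'. v = S' c" using S_eq[OF c(1), of d] d by (metis (no_types))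
  qed
  ultimately show ?thesis
    using b unfolding basis_family_def M S_def[symmetric] S'_def[symmetric] by blast
qed (simp add: basis_family_def M)

section \<open>The ring of linearized polynomials\<close>

lemma linearized_ring_simps:
  "F \<otimes>\<^bsub>linearized_ring r m\<^esub> G = F \<circ>\<^sub>p G" "\<one>\<^bsub>linearized_ring r m\<^esub> = [:0, 1:]"
  "\<zero>\<^bsub>linearized_ring r m\<^esub> = 0" "F \<oplus>\<^bsub>linearized_ring r m\<^esub> G = F + G"
  by (simp_all add: linearized_ring_def)

lemma linearized_sum:
  assumes "finite I" "\<And>i. i \<in> I \<Longrightarrow> c i \<in> GF m"
  shows "(\<Sum>i\<in>I. monom (c i) (CARD('f) ^ (r * i))) \<in> carrier (linearized_ring r m :: 'f::{field,finite} alg_closure poly ring)"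
proof -
  let ?c = "\<lambda>i. if i \<in> I then c i else 0"
  obtain N where N: "I \<subseteq> {..N}" using assms(1) finite_nat_iff_bounded_le by blast
  have "(\<Sum>i\<in>I. monom (c i) (CARD('f) ^ (r * i))) = (\<Sum>i\<le>N. monom (?c i) (CARD('f) ^ (r * i)))"
    using N by (intro sum.mono_neutral_cong_left) auto
  moreover have "\<forall>i. ?c i \<in> GF m" using assms(2) by auto
  ultimately show ?thesis by (auto simp: linearized_ring_def)
qed

lemma linearized_monom:
  "c \<in> GF m \<Longrightarrow> monom c (CARD('f) ^ (r * i)) \<in> carrier (linearized_ring r m :: 'f::{field,finite} alg_closure poly ring)"
  using linearized_sum[where I="{i}" and c="\<lambda>_. c" and m=m and r=r] by simp

lemma linearized_add:
  fixes F G :: "'f::{field,finite} alg_closure poly"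
  assumes "F \<in> carrier (linearized_ring r m)" "G \<in> carrier (linearized_ring r m)"
  shows "F + G \<in> carrier (linearized_ring r m)"
proof -
  let ?q = "\<lambda>i. CARD('f) ^ (r * i)"
  obtain c N d N' where F: "F = (\<Sum>i\<le>N. monom (c i) (?q i))" "\<forall>i. c i \<in> GF m"
    and G: "G = (\<Sum>i\<le>N'. monom (d i) (?q i))" "\<forall>i. d i \<in> GF m"
    using assms by (auto simp: linearized_ring_def)
  let ?c = "\<lambda>i. (if i \<le> N then c i else 0) + (if i \<le> N' then d i else 0)"
  have "F = (\<Sum>i\<le>max N N'. monom (if i \<le> N then c i else 0) (?q i))"
    unfolding F by (intro sum.mono_neutral_cong_left) auto
  moreover have "G = (\<Sum>i\<le>max N N'. monom (if i \<le> N' then d i else 0) (?q i))"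
    unfolding G by (intro sum.mono_neutral_cong_left) auto
  ultimately have "F + G = (\<Sum>i\<le>max N N'. monom (?c i) (?q i))"
    by (simp only: add_monom sum.distrib[symmetric])
  then show ?thesis using F G
    by (simp only:) (rule linearized_sum, auto intro: GF_add)
qed

lemma linearized_induct [consumes 1, case_names monom add]:
  fixes F :: "'f::{field,finite} alg_closure poly"
  assumes F: "F \<in> carrier (linearized_ring r m)"
    and monom: "\<And>c i. c \<in> GF m \<Longrightarrow> P (monom c (CARD('f) ^ (r * i)))"
    and add: "\<And>F G. F \<in> carrier (linearized_ring r m) \<Longrightarrow> G \<in> carrier (linearized_ring r m) \<Longrightarrow>
      P F \<Longrightarrow> P G \<Longrightarrow> P (F + G)"
  shows "P F"
proof -
  obtain c N where c: "F = (\<Sum>i\<le>N. monom (c i) (CARD('f) ^ (r * i)))" "\<forall>i. c i \<in> GF m"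
    using F by (auto simp: linearized_ring_def)
  have "P (\<Sum>i\<le>N. monom (c i) (CARD('f) ^ (r * i)))"
  proof (induction N)
    case 0
    show ?case using monom[of "c 0" 0] c(2) by simp
  next
    case (Suc N)
    then show ?case
      unfolding sum.atMost_Suc using c(2) by (intro add monom linearized_sum linearized_monom) auto
  qed
  then show ?thesis by (simp add: c)
qed

lemma pcompose_monom: "pcompose (monom c k) G = smult c (G ^ k)"
  for G :: "'a::comm_ring_1 poly"
  by (induction k) (simp_all add: monom_0 monom_Suc pcompose_pCons)

lemma pcompose_linearized_add:
  fixes F G H :: "'f::{field,finite} alg_closure poly"
  assumes "F \<in> carrier (linearized_ring r m)"
  shows "F \<circ>\<^sub>p (G + H) = F \<circ>\<^sub>p G + F \<circ>\<^sub>p H"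
  using assms
proof (induction F rule: linearized_induct)
  case (monom c i)
  have "(G + H) ^ (CARD('f) ^ (r * i)) = G ^ (CARD('f) ^ (r * i)) + H ^ (CARD('f) ^ (r * i))"
    by (rule power_card_add) (rule binomial_card_eq_0_closure)
  then show ?case by (simp add: pcompose_monom smult_add_right)
qed (simp add: pcompose_add algebra_simps)

lemma pcompose_linearized_monom:
  "pcompose (monom c (CARD('f) ^ (r * i))) (monom d (CARD('f) ^ (r * j))) =
     monom (c * frob (r * i) d) (CARD('f) ^ (r * (i + j)))"
  for c d :: "'f::{field,finite} alg_closure"
  by (simp add: pcompose_monom monom_power smult_monom frob_def algebra_simps power_add)

lemma linearized_pcompose:
  fixes F G :: "'f::{field,finite} alg_closure poly"
  assumes "F \<in> carrier (linearized_ring r m)" "G \<in> carrier (linearized_ring r m)"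
  shows "F \<circ>\<^sub>p G \<in> carrier (linearized_ring r m)"
  using assms(1)
proof (induction F rule: linearized_induct)
  case (monom c i)
  show ?case using assms(2)
  proof (induction G rule: linearized_induct)
    case (monom d j)
    then show ?case unfolding pcompose_linearized_monom
      using \<open>c \<in> GF m\<close> by (intro linearized_monom GF_mult GF_frob)
  next
    case (add F G)
    then show ?case
      using pcompose_linearized_add[OF linearized_monom[OF \<open>c \<in> GF m\<close>]] by (simp add: linearized_add)
  qed
qed (simp add: pcompose_add linearized_add)

lemma linearized_0: "0 \<in> carrier (linearized_ring r m)"
  using linearized_monom[of 0 m r 0] by simp

lemma linearized_uminus: "F \<in> carrier (linearized_ring r m) \<Longrightarrow> - F \<in> carrier (linearized_ring r m)"
proof (induction F rule: linearized_induct)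
  case (monom c i)
  then show ?case using linearized_monom[of "- c" m r i] by (simp add: GF_uminus minus_monom)
next
  case (add F G)
  then show ?case using linearized_add[OF add.IH] by simp
qed

lemma linearized_ring_ring: "ring (linearized_ring r m :: 'f::{field,finite} alg_closure poly ring)"
proof (rule ringI)
  show "abelian_group (linearized_ring r m :: 'f alg_closure poly ring)"
  proof (rule abelian_groupI)
    fix F :: "'f alg_closure poly" assume F: "F \<in> carrier (linearized_ring r m)"
    then show "\<exists>G\<in>carrier (linearized_ring r m). G \<oplus>\<^bsub>linearized_ring r m\<^esub> F = \<zero>\<^bsub>linearized_ring r m\<^esub>"
      by (intro bexI[of _ "- F"]) (auto simp: linearized_ring_simps linearized_uminus)
  qed (auto simp: linearized_ring_simps linearized_add linearized_0 add_ac)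
  have "[:0, 1:] \<in> carrier (linearized_ring r m :: 'f alg_closure poly ring)"
    using linearized_monom[of 1 m r 0] by (simp add: monom_altdef)
  then show "Group.monoid (linearized_ring r m :: 'f alg_closure poly ring)"
    by (intro monoidI)
      (auto simp: linearized_ring_simps linearized_pcompose pcompose_assoc pcompose_pCons)
qed (auto simp: linearized_ring_simps pcompose_add pcompose_linearized_add)

lemma poly_monom_frob: "poly (monom c (CARD('f) ^ k)) v = c * frob k v"
  for c :: "'f::{field,finite} alg_closure"
  by (simp add: poly_monom frob_def)

section \<open>The torsion module\<close>

lemma A_ring_simps [simp]:
  "carrier A_ring = UNIV" "a \<otimes>\<^bsub>A_ring\<^esub> b = a * b" "a \<oplus>\<^bsub>A_ring\<^esub> b = a + b"
  "\<one>\<^bsub>A_ring\<^esub> = 1" "\<zero>\<^bsub>A_ring\<^esub> = 0"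
  by (simp_all add: ring_of_type_algebra_def)

locale drinfeld_torsion = twisted_binomial t n m r
  for t :: "'f::{field,finite} alg_closure" and n m r :: nat +
  fixes p0 p :: "'f poly" and \<phi> :: "'f poly \<Rightarrow> 'f alg_closure poly"
  assumes p0_monic: "lead_coeff p0 = 1" and p0_irred: "irreducible p0" and p0_deg: "degree p0 = r"
    and p0_root: "poly (map_poly to_ac p0) t = 0"
    and \<phi>_hom: "twisted_algebra_hom r \<phi>" and \<phi>_T: "\<phi> [:0, 1:] = [:t:] + monom 1 n"
    and p_eq: "p = p0 - 1"
begin

definition \<Phi> :: "'f poly \<Rightarrow> 'f alg_closure \<Rightarrow> 'f alg_closure" where
  "\<Phi> a v = twisted_apply (\<phi> a) v"

lemma \<Phi>_add: "\<Phi> (a + b) v = \<Phi> a v + \<Phi> b v"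
  and \<Phi>_mult: "\<Phi> (a * b) v = \<Phi> a (\<Phi> b v)"
  and \<Phi>_const: "\<Phi> [:c:] v = to_ac c * v"
proof -
  have hom: "\<phi> \<in> ring_hom A_ring (twisted_ring (GF r))" and const: "\<phi> [:c:] = [:to_ac c:]" for c
    using \<phi>_hom by (auto simp: twisted_algebra_hom_def)
  show "\<Phi> (a + b) v = \<Phi> a v + \<Phi> b v"
    using ring_hom_add[OF hom, of a b] by (simp add: \<Phi>_def twisted_ring_def twisted_apply_add)
  show "\<Phi> (a * b) v = \<Phi> a (\<Phi> b v)"
    using ring_hom_mult[OF hom, of a b] by (simp add: \<Phi>_def twisted_ring_def twisted_apply_mult)
  show "\<Phi> [:c:] v = to_ac c * v"
    by (simp add: \<Phi>_def const twisted_apply_const)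
qed

lemma \<Phi>_X: "\<Phi> [:0, 1:] v = T v"
  by (simp add: \<Phi>_def \<phi>_T twisted_apply_add twisted_apply_const twisted_apply_monom T_def
      del: add_pCons)

lemma \<Phi>_eq: "\<Phi> a v = eval_T (map_poly to_ac a) v"
proof (induction a arbitrary: v rule: pCons_induct)
  case 0
  show ?case using \<Phi>_const[of 0 v] by (simp add: eval_T_def)
next
  case (pCons c a)
  have "pCons c a = [:c:] + a * [:0, 1:]" by simp
  then have "\<Phi> (pCons c a) v = to_ac c * v + \<Phi> a (T v)"
    by (simp only: \<Phi>_add \<Phi>_mult \<Phi>_const \<Phi>_X)
  then show ?case using pCons by (simp add: map_poly_pCons eval_T_pCons)
qed

lemma \<Phi>_sum: "\<Phi> a v = (\<Sum>l\<le>degree a. to_ac (coeff a l) * (T ^^ l) v)"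
  by (simp add: \<Phi>_eq eval_T_def degree_map_poly_to_ac coeff_map_poly)

lemma \<Phi>_diff: "\<Phi> (a - b) v = \<Phi> a v - \<Phi> b v"
  using \<Phi>_add[of "a - b" b v] by simp

lemma \<Phi>_monom: "\<Phi> (monom 1 i) v = (T ^^ i) v"
proof (induction i arbitrary: v)
  case 0
  show ?case using \<Phi>_const[of 1] by (simp add: monom_0 flip: one_pCons)
next
  case (Suc i)
  have "monom 1 (Suc i) = monom 1 i * ([:0, 1:] :: 'f poly)" by (simp add: monom_Suc)
  then show ?case by (simp only: \<Phi>_mult Suc \<Phi>_X funpow_Suc_right o_apply)
qed

lemma \<Phi>_p: "\<Phi> p v = frob (n * r) v - v"
  using \<Phi>_const[of 1 v] irreducible_eq_conj_prod[OF p0_monic p0_irred p0_deg p0_root]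
  by (simp add: p_eq \<Phi>_diff one_pCons) (simp add: \<Phi>_eq eval_T_conj_prod)

lemma \<Phi>_V: "v \<in> V \<Longrightarrow> \<Phi> a v \<in> V"
  by (simp add: \<Phi>_sum GF_sum GF_mult GF_to_ac Tpow_V)

lemma \<Phi>_add_arg: "\<Phi> a (v + w) = \<Phi> a v + \<Phi> a w"
  by (simp add: \<Phi>_sum Tpow_add distrib_left sum.distrib)

lemma \<Phi>_0 [simp]: "\<Phi> a 0 = 0"
  by (simp add: \<Phi>_sum)

lemma \<Phi>_mult_GF: "c \<in> GF n \<Longrightarrow> \<Phi> a (c * v) = c * \<Phi> a v"
  by (simp add: \<Phi>_sum Tpow_mult_GF sum_distrib_left mult.left_commute)

lemma \<Phi>_frob: "\<Phi> a (frob (r * j) v) = frob (r * j) (\<Phi> a v)"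
  by (simp add: \<Phi>_sum Tpow_frob frob_sum frob_mult)

abbreviation K :: "'f poly set ring" where "K \<equiv> residue_field p"
abbreviation M :: "('f poly set, 'f alg_closure) module" where "M \<equiv> torsion_module \<phi> p"

definition resid :: "'f poly \<Rightarrow> 'f poly set" where "resid a = PIdl\<^bsub>A_ring\<^esub> p +>\<^bsub>A_ring\<^esub> a"

lemma M_simps [simp]:
  "carrier M = V" "v \<oplus>\<^bsub>M\<^esub> w = v + w" "\<zero>\<^bsub>M\<^esub> = 0"
  using \<Phi>_p by (auto simp: torsion_module_def GF_def \<Phi>_def)

lemma ideal_p: "ideal (PIdl\<^bsub>A_ring\<^esub> p) A_ring"
  by (rule cring.cgenideal_ideal[OF cring_from_type_algebra]) simp

lemma resid_hom: "ring_hom_ring A_ring K resid"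
  using ideal.rcos_ring_hom_ring[OF ideal_p] unfolding residue_field_def resid_def[abs_def] .

lemma K_cring: "cring K"
  unfolding residue_field_def by (rule ideal.quotient_is_cring[OF ideal_p cring_from_type_algebra])

lemma carrier_K: "carrier K = range resid"
  by (auto simp: residue_field_def FactRing_def A_RCOSETS_def' resid_def)

lemma resid_simps:
  "resid a \<in> carrier K" "resid a \<oplus>\<^bsub>K\<^esub> resid b = resid (a + b)" "resid a \<otimes>\<^bsub>K\<^esub> resid b = resid (a * b)"
  "\<one>\<^bsub>K\<^esub> = resid 1" "\<zero>\<^bsub>K\<^esub> = resid 0"
proof -
  interpret ring_hom_ring A_ring K resid by (rule resid_hom)
  show "resid a \<in> carrier K" "resid a \<oplus>\<^bsub>K\<^esub> resid b = resid (a + b)" "resid a \<otimes>\<^bsub>K\<^esub> resid b = resid (a * b)"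
    "\<one>\<^bsub>K\<^esub> = resid 1" "\<zero>\<^bsub>K\<^esub> = resid 0"
    using hom_add[of a b] hom_mult[of a b] hom_one hom_zero hom_closed[of a] by simp_all
qed

lemma resid_eq: "resid a = {x * p + a | x. True}"
  by (auto simp: resid_def a_r_coset_def' cgenideal_def)

lemma resid_eq_iff: "resid a = resid b \<longleftrightarrow> p dvd a - b"
proof
  assume "resid a = resid b"
  moreover have "a \<in> resid a" unfolding resid_eq by (auto intro: exI[of _ 0])
  ultimately obtain x where "a = x * p + b" by (auto simp: resid_eq)
  then show "p dvd a - b" by simp
next
  assume "p dvd a - b"
  then obtain y where y: "a = p * y + b" by (metis dvdE diff_add_cancel)
  have "x * p + a = (x + y) * p + b" "x * p + b = (x - y) * p + a" for x
    unfolding y by (simp_all add: algebra_simps)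
  then show "resid a = resid b" unfolding resid_eq by blast
qed

text \<open>
  The action does not depend on the representative, because \<open>p\<close> acts as \<open>\<tau>\<^bsup>nr\<^esup> - 1\<close>, which is zero on
  \<open>V\<close>.
\<close>

lemma smult_resid: "v \<in> V \<Longrightarrow> resid a \<odot>\<^bsub>M\<^esub> v = \<Phi> a v"
proof -
  assume v: "v \<in> V"
  have "\<Phi> (x * p + a) v = \<Phi> a v" for x
    using v by (simp add: \<Phi>_add \<Phi>_mult \<Phi>_p) (simp add: GF_def)
  then have "(\<lambda>b. twisted_apply (\<phi> b) v) ` resid a = {\<Phi> a v}"
    unfolding resid_eq \<Phi>_def[symmetric] by force
  then show ?thesis by (simp add: torsion_module_def)
qed

lemma M_module: "module K M"
proof (rule moduleI)
  show "cring K" by (rule K_cring)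
  show "abelian_group M"
    by (rule abelian_groupI) (auto simp: GF_add add_ac intro!: bexI[of _ "- x" for x] GF_uminus)
qed (auto simp: carrier_K resid_simps smult_resid \<Phi>_V \<Phi>_add_arg \<Phi>_add \<Phi>_mult \<Phi>_const GF_add
    one_pCons)

lemma p_deg: "degree p = r"
proof -
  have "degree (1 :: 'f poly) < degree p0" using p0_deg r_pos by simp
  then show ?thesis unfolding p_eq diff_conv_add_uminus
    by (subst degree_add_eq_left) (simp_all add: p0_deg)
qed

lemma resid_mod: "resid (a mod p) = resid a" and degree_mod_p: "degree (a mod p) < r"
proof -
  have "p \<noteq> 0" using p_deg r_pos by auto
  then show "degree (a mod p) < r"
    using degree_mod_less[of p a] p_deg r_pos by auto
  show "resid (a mod p) = resid a"
    unfolding resid_eq_iff by (metis dvd_minus_iff dvd_minus_mod minus_diff_eq)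
qed

section \<open>The centralizer \<open>R\<close>\<close>

abbreviation E where "E \<equiv> End_ring K M"
abbreviation R where "R \<equiv> skew_code_ring K M r m"
abbreviation \<pi> where "\<pi> \<equiv> frob_op V r"

lemma E_ring: "ring E"
  by (rule module.End_ring_ring[OF M_module])

lemma E_iff: "f \<in> carrier E \<longleftrightarrow> f \<in> V \<rightarrow>\<^sub>E V \<and> (\<forall>v\<in>V. \<forall>w\<in>V. f (v + w) = f v + f w) \<and>
    (\<forall>a. \<forall>v\<in>V. f (\<Phi> a v) = \<Phi> a (f v))"
  unfolding End_ring_simps(1) by (auto simp: carrier_K smult_resid PiE_iff)

lemma E_restrictI:
  assumes "\<And>v. v \<in> V \<Longrightarrow> f v \<in> V" "\<And>v w. f (v + w) = f v + f w" "\<And>a v. f (\<Phi> a v) = \<Phi> a (f v)"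
  shows "restrict f V \<in> carrier E"
  using assms by (auto simp: E_iff GF_add \<Phi>_V)

lemma scalar_op_resid: "scalar_op M (resid a) = restrict (\<Phi> a) V"
  unfolding scalar_op_def M_simps by (intro restrict_ext) (simp add: smult_resid)

lemma scalar_op_E: "scalar_op M (resid a) \<in> carrier E"
  unfolding scalar_op_resid
  by (rule E_restrictI) (auto simp: \<Phi>_V \<Phi>_add_arg mult.commute simp flip: \<Phi>_mult)

lemma frob_pow_E: "restrict (frob (r * j)) V \<in> carrier E"
  by (rule E_restrictI) (auto simp: GF_frob frob_add \<Phi>_frob)

lemma \<pi>_pow: "\<pi> [^]\<^bsub>E\<^esub> k = restrict (frob (r * k)) V"
proof (induction k)
  case 0
  show ?case by (auto simp: nat_pow_def End_ring_simps intro!: restrict_ext)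
next
  case (Suc k)
  have "\<pi> [^]\<^bsub>E\<^esub> Suc k = \<pi> [^]\<^bsub>E\<^esub> k \<otimes>\<^bsub>E\<^esub> \<pi>" by (simp add: nat_pow_def)
  also have "\<dots> = restrict (frob (r * Suc k)) V"
    unfolding Suc by (auto simp: End_ring_simps frob_op_def compose_def GF_frob frob_frob algebra_simps
        intro!: restrict_ext)
  finally show ?case .
qed

lemma R_gens: "scalar_op M ` carrier K \<union> {\<pi> [^]\<^bsub>E\<^esub> m} \<subseteq> carrier E"
  using scalar_op_E frob_pow_E by (auto simp: carrier_K \<pi>_pow)

lemma R_eq: "R = centralizer_ring E (generate_ring E (scalar_op M ` carrier K \<union> {\<pi> [^]\<^bsub>E\<^esub> m}))"
  by (simp add: skew_code_ring_def Let_def)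

lemma R_ring: "ring R"
  unfolding R_eq
  by (rule centralizer_ring_ring[OF E_ring ring.generate_ring_incl[OF E_ring R_gens]])

lemma R_simps:
  "f \<otimes>\<^bsub>R\<^esub> g = compose V f g" "\<one>\<^bsub>R\<^esub> = (\<lambda>v\<in>V. v)"
  "\<zero>\<^bsub>R\<^esub> = (\<lambda>v\<in>V. 0)" "f \<oplus>\<^bsub>R\<^esub> g = (\<lambda>v\<in>V. f v + g v)"
  by (simp_all add: R_eq centralizer_ring_def End_ring_def)

text \<open>
  It suffices to commute with the generators of \<open>R\<^sub>0\<close>, and commuting with the scalars from \<open>\<kappa>\<close> is
  already part of being an endomorphism.
\<close>

lemma R_iff: "f \<in> carrier R \<longleftrightarrow>
    f \<in> carrier E \<and> (\<forall>v\<in>V. f (frob (r * m) v) = frob (r * m) (f v))"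
proof -
  let ?H = "scalar_op M ` carrier K \<union> {\<pi> [^]\<^bsub>E\<^esub> m}"
  have comm_\<pi>: "f \<otimes>\<^bsub>E\<^esub> (\<pi> [^]\<^bsub>E\<^esub> m) = (\<pi> [^]\<^bsub>E\<^esub> m) \<otimes>\<^bsub>E\<^esub> f \<longleftrightarrow>
      (\<forall>v\<in>V. f (frob (r * m) v) = frob (r * m) (f v))" if "f \<in> carrier E"
    using that by (auto simp: E_iff End_ring_simps(2) \<pi>_pow compose_def fun_eq_iff GF_frob PiE_iff)
  have comm_K: "f \<otimes>\<^bsub>E\<^esub> g = g \<otimes>\<^bsub>E\<^esub> f" if "f \<in> carrier E" "g \<in> scalar_op M ` carrier K" for g
    using that by (auto simp: E_iff End_ring_simps(2) carrier_K scalar_op_resid compose_def fun_eq_iff \<Phi>_V PiE_iff)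
  have "(\<forall>g\<in>generate_ring E ?H. f \<otimes>\<^bsub>E\<^esub> g = g \<otimes>\<^bsub>E\<^esub> f) \<longleftrightarrow> (\<forall>g\<in>?H. f \<otimes>\<^bsub>E\<^esub> g = g \<otimes>\<^bsub>E\<^esub> f)"
    if "f \<in> carrier E"
    using ring.commute_generate_ring[OF E_ring that R_gens] generate_ring.incl[of _ ?H E] by blast
  then show ?thesis
    using comm_\<pi> comm_K by (auto simp: R_eq centralizer_ring_def)
qed

lemma R_restrictI:
  assumes "\<And>v. v \<in> V \<Longrightarrow> f v \<in> V" "\<And>v w. f (v + w) = f v + f w" "\<And>a v. f (\<Phi> a v) = \<Phi> a (f v)"
    "\<And>v. f (frob (r * m) v) = frob (r * m) (f v)"
  shows "restrict f V \<in> carrier R"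
  using E_restrictI[OF assms(1-3)] assms(4) by (auto simp: R_iff GF_frob)

lemma frob_mult_GF_m: "c \<in> GF m \<Longrightarrow> frob (r * m) c = c"
  using frob_mult_GF[of c m r] by (simp add: mult.commute)

lemma comb_R:
  assumes c: "\<And>x. c x \<in> GF m"
  shows "restrict (comb c) V \<in> carrier R"
proof (rule R_restrictI)
  fix a v
  have "\<Phi> a (sum f A) = (\<Sum>x\<in>A. \<Phi> a (f x))" for f and A :: "(nat \<times> nat) set"
    by (induction A rule: infinite_finite_induct) (auto simp: \<Phi>_add_arg)
  moreover have "mono_op x (\<Phi> a v) = \<Phi> a (mono_op x v)" for x
    by (simp add: mono_op_def \<Phi>_frob[symmetric])
      (simp add: mult.commute flip: \<Phi>_monom \<Phi>_mult)
  moreover have "c x \<in> GF n" for x using c GF_sub_V by blast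
  ultimately show "comb c (\<Phi> a v) = \<Phi> a (comb c v)"
    by (simp add: comb_def \<Phi>_mult_GF)
next
  fix v assume "v \<in> V"
  then show "comb c v \<in> V" using c GF_sub_V(4) by (intro comb_V) auto
qed (simp_all add: c comb_def mono_op_add mono_op_frob frob_sum frob_mult frob_mult_GF_m
    distrib_left sum.distrib)

lemma R_eq_comb:
  assumes "f \<in> carrier R"
  shows "\<exists>c. (\<forall>x. c x \<in> GF m) \<and> f = restrict (comb c) V"
proof -
  have f: "f \<in> V \<rightarrow>\<^sub>E V" "\<And>v w. v \<in> V \<Longrightarrow> w \<in> V \<Longrightarrow> f (v + w) = f v + f w"
    "\<And>a v. v \<in> V \<Longrightarrow> f (\<Phi> a v) = \<Phi> a (f v)"
    "\<And>v. v \<in> V \<Longrightarrow> f (frob (r * m) v) = frob (r * m) (f v)"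
    using assms by (auto simp: R_iff E_iff)
  have "linearized_on (n * r) f"
  proof (rule linearized_on_of_linear)
    show "0 < n * r" using n_pos r_pos by simp
    show "f (to_ac a * v) = to_ac a * f v" if "v \<in> V" for a v
      using f(3)[OF that, of "[:a:]"] by (simp add: \<Phi>_const)
  qed (use f in \<open>auto simp: PiE_iff\<close>)
  from commutant_eq_comb[OF this] obtain c where "\<forall>x. c x \<in> GF m" "\<forall>v\<in>V. f v = comb c v"
    using f(3)[of _ "[:0, 1:]"] f(4) by (auto simp: \<Phi>_X)
  then show ?thesis using f(1) by (intro exI[of _ c]) (auto simp: PiE_iff extensional_def)
qed

lemma R_finsum:
  "finite I \<Longrightarrow> f \<in> I \<rightarrow> carrier R \<Longrightarrow> (\<Oplus>\<^bsub>R\<^esub>i\<in>I. f i) = (\<lambda>v\<in>V. \<Sum>i\<in>I. f i v)"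
proof (induction I rule: finite_induct)
  case empty
  interpret R: ring R by (rule R_ring)
  show ?case by (simp add: R_simps)
next
  case (insert i I)
  interpret R: ring R by (rule R_ring)
  from insert have "f \<in> I \<rightarrow> carrier R" "f i \<in> carrier R" by auto
  then show ?case using insert by (auto simp: R.finsum_insert R_simps intro!: restrict_ext)
qed

end

lemma mem_a_kernel_iff: "x \<in> a_kernel R S h \<longleftrightarrow> x \<in> carrier R \<and> h x = \<zero>\<^bsub>S\<^esub>"
  by (simp only: a_kernel_def' mem_Collect_eq)

context drinfeld_torsion
begin

section \<open>Evaluation of linearized polynomials\<close>

abbreviation Lin :: "'f alg_closure poly ring" where "Lin \<equiv> linearized_ring r m"
abbreviation L where "L \<equiv> field_scalar_ops V m"
abbreviation RMP :: "'f alg_closure poly set ring" where "RMP \<equiv> MP_ring r m n"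
abbreviation ev where "ev \<equiv> MP_op V"
abbreviation Gen where "Gen \<equiv> generate_ring R (L \<union> {\<pi>})"

definition lin_op :: "'f alg_closure poly \<Rightarrow> 'f alg_closure \<Rightarrow> 'f alg_closure" where
  "lin_op F = restrict (poly F) V"

definition reduced :: "(nat \<Rightarrow> 'f alg_closure) \<Rightarrow> 'f alg_closure poly" where
  "reduced \<beta> = (\<Sum>j<n. monom (\<beta> j) (CARD('f) ^ (r * j)))"

lemma \<Phi>_commute: "\<Phi> a (\<Phi> b v) = \<Phi> b (\<Phi> a v)"
  by (simp add: mult.commute flip: \<Phi>_mult)

lemma gens_R: "L \<union> {\<pi>} \<subseteq> carrier R"
proof -
  have "(\<lambda>v\<in>V. c * v) \<in> carrier R" if c: "c \<in> GF m" for c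
    using c GF_sub_V
    by (intro R_restrictI) (auto simp: GF_mult distrib_left frob_mult frob_mult_GF_m \<Phi>_mult_GF subset_iff)
  moreover have "\<pi> \<in> carrier R"
    unfolding frob_op_def using \<Phi>_frob[of _ 1]
    by (intro R_restrictI) (auto simp: GF_frob frob_add frob_comm)
  ultimately show ?thesis by (auto simp: field_scalar_ops_def)
qed

lemma Gen_R: "Gen \<subseteq> carrier R"
  by (rule ring.generate_ring_incl[OF R_ring gens_R])

lemma lin_op_monom: "lin_op (monom c (CARD('f) ^ k)) = (\<lambda>v\<in>V. c * frob k v)"
  unfolding lin_op_def by (rule restrict_ext) (simp add: poly_monom_frob)

lemma lin_op_Gen:
  assumes "F \<in> carrier Lin"
  shows "lin_op F \<in> Gen"
  using assms
proof (induction F rule: linearized_induct)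
  case (monom c i)
  have "restrict (frob (r * i)) V \<in> Gen" for i
  proof (induction i)
    case 0
    have "restrict (frob (r * 0)) V = \<one>\<^bsub>R\<^esub>" unfolding R_simps by (rule restrict_ext) simp
    then show ?case by (simp only: generate_ring.one)
  next
    case (Suc i)
    have eq: "\<pi> \<otimes>\<^bsub>R\<^esub> restrict (frob (r * i)) V = restrict (frob (r * Suc i)) V"
      by (auto simp: R_simps compose_def frob_op_def GF_frob frob_frob intro!: restrict_ext)
    have "\<pi> \<otimes>\<^bsub>R\<^esub> restrict (frob (r * i)) V \<in> Gen"
      by (intro generate_ring.eng_mult[OF generate_ring.incl Suc]) simp
    then show ?case by (simp only: eq)
  qed
  moreover have "(\<lambda>v\<in>V. c * v) \<in> Gen"
    using monom by (intro generate_ring.incl) (auto simp: field_scalar_ops_def)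
  ultimately have "(\<lambda>v\<in>V. c * v) \<otimes>\<^bsub>R\<^esub> restrict (frob (r * i)) V \<in> Gen"
    by (intro generate_ring.eng_mult)
  moreover have "(\<lambda>v\<in>V. c * v) \<otimes>\<^bsub>R\<^esub> restrict (frob (r * i)) V = lin_op (monom c (CARD('f) ^ (r * i)))"
    by (auto simp: lin_op_monom R_simps compose_def GF_frob intro!: restrict_ext)
  ultimately show ?case by simp
next
  case (add F G)
  have "lin_op (F + G) = lin_op F \<oplus>\<^bsub>R\<^esub> lin_op G" by (auto simp: lin_op_def R_simps intro!: restrict_ext)
  then show ?case using add by (simp add: generate_ring.eng_add)
qed

lemma lin_op_hom: "ring_hom_ring Lin R lin_op"
proof (rule ring_hom_ringI2[OF linearized_ring_ring R_ring], rule ring_hom_memI)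
  fix F assume F: "F \<in> carrier Lin"
  then show "lin_op F \<in> carrier R" using lin_op_Gen Gen_R by blast
  fix G assume G: "G \<in> carrier Lin"
  then have "lin_op G v \<in> V" if "v \<in> V" for v
    using lin_op_Gen[OF G] Gen_R that by (auto simp: R_iff E_iff PiE_iff)
  then show "lin_op (F \<otimes>\<^bsub>Lin\<^esub> G) = lin_op F \<otimes>\<^bsub>R\<^esub> lin_op G"
    by (auto simp: linearized_ring_simps R_simps compose_def lin_op_def poly_pcompose intro!: restrict_ext)
  show "lin_op (F \<oplus>\<^bsub>Lin\<^esub> G) = lin_op F \<oplus>\<^bsub>R\<^esub> lin_op G"
    by (auto simp: linearized_ring_simps R_simps lin_op_def intro!: restrict_ext)
qed (auto simp: linearized_ring_simps R_simps lin_op_def intro!: restrict_ext)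

lemma lin_op_image: "lin_op ` carrier Lin = Gen"
proof
  show "lin_op ` carrier Lin \<subseteq> Gen" using lin_op_Gen by blast
  interpret lin_op: ring_hom_ring Lin R lin_op by (rule lin_op_hom)
  have "L \<subseteq> lin_op ` carrier Lin"
  proof
    fix f assume "f \<in> L"
    then obtain c where "f = (\<lambda>v\<in>V. c * v)" "c \<in> GF m" by (auto simp: field_scalar_ops_def)
    then have "f = lin_op (monom c (CARD('f) ^ (r * 0)))" by (simp only: lin_op_monom) simp
    then show "f \<in> lin_op ` carrier Lin" using linearized_monom[OF \<open>c \<in> GF m\<close>] by blast
  qed
  moreover have "\<pi> = lin_op (monom 1 (CARD('f) ^ (r * 1)))"
    by (simp add: lin_op_monom frob_op_def)
  then have "\<pi> \<in> lin_op ` carrier Lin" by (rule image_eqI) (rule linearized_monom[OF GF_1])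
  ultimately show "Gen \<subseteq> lin_op ` carrier Lin"
    using lin_op.img_is_subring[OF ring.carrier_is_subring[OF linearized_ring_ring]]
    by (intro ring.generate_ring_min_subring1[OF R_ring gens_R]) auto
qed

lemma MP_gen_Lin: "{monom 1 (CARD('f) ^ (r * n)) - monom 1 1} \<subseteq> carrier Lin"
  using linearized_monom[of 1 m r n]
    linearized_add[OF linearized_monom[of 1 m r n] linearized_uminus[OF linearized_monom[of 1 m r 0]]]
  by simp

lemma MP_ideal_ideal: "ideal (MP_ideal r m n) Lin"
  unfolding MP_ideal_def by (rule ring.genideal_ideal[OF linearized_ring_ring MP_gen_Lin])

lemma MP_ideal_add: "F \<in> MP_ideal r m n \<Longrightarrow> G \<in> MP_ideal r m n \<Longrightarrow> F + G \<in> (MP_ideal r m n :: 'f alg_closure poly set)"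
  using additive_subgroup.a_closed[OF ideal.axioms(1)[OF MP_ideal_ideal]]
  by (auto simp: linearized_ring_simps)

lemma reduced_Lin: "(\<And>j. \<beta> j \<in> GF m) \<Longrightarrow> reduced \<beta> \<in> carrier Lin"
  unfolding reduced_def by (rule linearized_sum) auto

text \<open>
  Modulo the ideal, \<open>r j\<close> and \<open>r (j + n)\<close> are the same exponent: composing \<open>c x\<^bsup>[rj]\<^esup>\<close> with the
  generator \<open>x\<^bsup>[rn]\<^esup> - x\<close> gives their difference.
\<close>

lemma reduction:
  assumes "F \<in> carrier Lin"
  shows "\<exists>\<beta>. (\<forall>j. \<beta> j \<in> GF m) \<and> F - reduced \<beta> \<in> MP_ideal r m n"
  using assms
proof (induction F rule: linearized_induct)
  case (monom c i)
  let ?q = "\<lambda>i. CARD('f) ^ (r * i)"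
  have zero: "0 \<in> (MP_ideal r m n :: 'f alg_closure poly set)"
    using additive_subgroup.zero_closed[OF ideal.axioms(1)[OF MP_ideal_ideal]]
    by (simp add: linearized_ring_simps)
  have gen: "monom 1 (?q n) - monom 1 1 \<in> (MP_ideal r m n :: 'f alg_closure poly set)"
    using ring.genideal_self[OF linearized_ring_ring MP_gen_Lin] unfolding MP_ideal_def by blast
  have step: "monom c (?q (j + n)) - monom c (?q j) \<in> MP_ideal r m n" for j
  proof -
    have "monom c (?q j) \<circ>\<^sub>p (monom 1 (?q n) - monom 1 1) \<in> MP_ideal r m n"
      using ideal.I_l_closed[OF MP_ideal_ideal gen linearized_monom[OF monom, of r j]]
      by (simp add: linearized_ring_simps)
    moreover have "monom c (?q j) \<circ>\<^sub>p (monom 1 (?q n) - monom 1 1) = monom c (?q (j + n)) - monom c (?q j)"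
    proof -
      have "monom c (?q j) \<circ>\<^sub>p (monom 1 (?q n) + monom (- 1) (?q 0)) =
          monom c (?q (j + n)) + monom (- c) (?q j)"
        by (subst pcompose_linearized_add[OF linearized_monom[OF monom]])
           (simp only: pcompose_linearized_monom frob_1 frob_minus mult_1_right mult_minus_right add_0_right)
      then show ?thesis by (simp only: diff_conv_add_uminus minus_monom mult_0_right power_0)
    qed
    ultimately show ?thesis by simp
  qed
  have red: "monom c (?q (j + n * k)) - monom c (?q j) \<in> MP_ideal r m n" for j k
  proof (induction k)
    case (Suc k)
    have "monom c (?q (j + n * Suc k)) - monom c (?q j) =
        (monom c (?q ((j + n * k) + n)) - monom c (?q (j + n * k))) + (monom c (?q (j + n * k)) - monom c (?q j))"
      by (simp add: add.assoc add.commute[of n])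
    then show ?case using MP_ideal_add[OF step[of "j + n * k"] Suc] by (simp only:)
  qed (simp add: zero)
  define \<beta> where "\<beta> = (\<lambda>j. if j = i mod n then c else 0)"
  have "reduced \<beta> = (\<Sum>j<n. if j = i mod n then monom c (?q j) else 0)"
    unfolding reduced_def \<beta>_def by (intro sum.cong) auto
  also have "\<dots> = monom c (?q (i mod n))" using n_pos by simp
  finally have "monom c (?q i) - reduced \<beta> \<in> MP_ideal r m n"
    using red[of "i mod n" "i div n"] by simp
  then show ?case using monom by (intro exI[of _ \<beta>]) (auto simp: \<beta>_def)
next
  case (add F G)
  then obtain \<beta> \<gamma> where \<beta>: "\<forall>j. \<beta> j \<in> GF m" "F - reduced \<beta> \<in> MP_ideal r m n"
    and \<gamma>: "\<forall>j. \<gamma> j \<in> GF m" "G - reduced \<gamma> \<in> MP_ideal r m n" by blast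
  have "reduced (\<lambda>j. \<beta> j + \<gamma> j) = reduced \<beta> + reduced \<gamma>"
    by (simp add: reduced_def sum.distrib flip: add_monom)
  then have "F + G - reduced (\<lambda>j. \<beta> j + \<gamma> j) \<in> MP_ideal r m n"
    using MP_ideal_add[OF \<beta>(2) \<gamma>(2)] by (simp add: algebra_simps)
  then show ?case using \<beta>(1) \<gamma>(1)
    by (intro exI[of _ "\<lambda>j. \<beta> j + \<gamma> j"]) (simp add: GF_add)
qed

lemma poly_reduced: "poly (reduced \<beta>) v = (\<Sum>j<n. \<beta> j * frob (r * j) v)"
  by (simp add: reduced_def poly_sum poly_monom_frob)

text \<open>
  Grouping the double sum \<open>comb\<close> by the powers of \<open>T\<close>, each row is a reduced linearized polynomial. In
  these coordinates \<open>R\<close> is visibly the tensor product of \<open>\<kappa>\<close>, with basis \<open>1, T, \<dots>, T\<^bsup>r-1\<^esup>\<close>, and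
  \<open>R\<^bsub>MP\<^esub>\<close>.
\<close>

lemma \<Phi>_poly_reduced:
  assumes \<beta>: "\<And>i j. \<beta> i j \<in> GF m"
  shows "(\<Sum>i<r. \<Phi> (monom 1 i) (poly (reduced (\<beta> i)) v)) = comb (\<lambda>(i, j). \<beta> i j) v"
proof -
  have "\<beta> i j \<in> GF n" for i j using \<beta> GF_sub_V by blast
  then show ?thesis
    by (simp add: \<Phi>_monom poly_reduced Tpow_sum Tpow_mult_GF comb_def idx_def mono_op_def
        sum.cartesian_product case_prod_unfold)
qed

lemma comb_eq_0:
  assumes "\<And>x. c x \<in> GF m" "\<And>v. v \<in> V \<Longrightarrow> comb c v = 0" "i < r" "j < n"
  shows "c (i, j) = 0"
  using comb_inj[of c "\<lambda>x. 0" "(i, j)"] assms GF_sub_V(4) by (force simp: comb_def idx_def)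

lemma reduced_eq_0:
  assumes \<beta>: "\<And>j. \<beta> j \<in> GF m" and zero: "\<And>v. v \<in> V \<Longrightarrow> poly (reduced \<beta>) v = 0"
  shows "reduced \<beta> = 0"
proof -
  \<comment> \<open>A reduced polynomial is the row \<open>i = 0\<close> of \<open>comb\<close>.\<close>
  define \<gamma> where "\<gamma> = (\<lambda>i::nat. if i = 0 then \<beta> else (\<lambda>j. 0))"
  have \<gamma>: "\<gamma> i j \<in> GF m" for i j using \<beta> by (simp add: \<gamma>_def)
  have "poly (reduced (\<gamma> i)) v = 0" if "v \<in> V" for i v
    using zero[OF that] by (simp add: \<gamma>_def poly_reduced)
  then have "comb (\<lambda>(i, j). \<gamma> i j) v = 0" if "v \<in> V" for v
    using \<Phi>_poly_reduced[of \<gamma> v, OF \<gamma>] that by simp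
  then have "j < n \<Longrightarrow> \<gamma> 0 j = 0" for j
    using comb_eq_0[of "\<lambda>(i, j). \<gamma> i j" 0 j] \<gamma> r_pos by auto
  then show ?thesis by (simp add: reduced_def \<gamma>_def)
qed

text \<open>
  A polynomial that vanishes on \<open>V\<close> is congruent to a reduced one that also vanishes on \<open>V\<close>; by the
  independence of the operators \<open>mono_op\<close> that one is zero.
\<close>

lemma lin_op_kernel: "a_kernel Lin R lin_op = MP_ideal r m n"
proof
  interpret lin_op: ring_hom_ring Lin R lin_op by (rule lin_op_hom)
  have "lin_op (monom 1 (CARD('f) ^ (r * n)) - monom 1 1) = \<zero>\<^bsub>R\<^esub>"
  proof -
    have "poly (monom 1 (CARD('f) ^ (r * n)) - monom 1 1) v = 0" if "v \<in> V" for v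
      using that poly_monom_frob[of 1 "r * n" v] by (simp add: GF_def mult.commute poly_monom)
    then show ?thesis by (auto simp: lin_op_def R_simps intro!: restrict_ext)
  qed
  then have "{monom 1 (CARD('f) ^ (r * n)) - monom 1 1} \<subseteq> a_kernel Lin R lin_op"
    using MP_gen_Lin by (simp only: insert_subset empty_subsetI mem_a_kernel_iff simp_thms)
  then show sub: "MP_ideal r m n \<subseteq> a_kernel Lin R lin_op"
    unfolding MP_ideal_def by (rule ring.genideal_minimal[OF linearized_ring_ring lin_op.kernel_is_ideal])
  show "a_kernel Lin R lin_op \<subseteq> MP_ideal r m n"
  proof
    fix F assume "F \<in> a_kernel Lin R lin_op"
    then have F: "F \<in> carrier Lin" "lin_op F = \<zero>\<^bsub>R\<^esub>" by (simp_all only: mem_a_kernel_iff)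
    obtain \<beta> where \<beta>: "\<forall>j. \<beta> j \<in> GF m" "F - reduced \<beta> \<in> MP_ideal r m n"
      using reduction[OF F(1)] by blast
    have "lin_op (F - reduced \<beta>) = \<zero>\<^bsub>R\<^esub>"
      using subsetD[OF sub \<beta>(2)] by (simp only: mem_a_kernel_iff)
    then have "poly (reduced \<beta>) v = 0" if "v \<in> V" for v
      using F(2) that unfolding lin_op_def R_simps by (auto dest!: fun_cong[of _ _ v])
    then have "reduced \<beta> = 0" using \<beta>(1) by (intro reduced_eq_0) auto
    then show "F \<in> MP_ideal r m n" using \<beta>(2) by simp
  qed
qed

definition mp_class :: "'f alg_closure poly \<Rightarrow> 'f alg_closure poly set" where
  "mp_class F = MP_ideal r m n +>\<^bsub>Lin\<^esub> F"

lemma RMP_ring: "ring RMP"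
  unfolding MP_ring_def by (rule ideal.quotient_is_ring[OF MP_ideal_ideal])

lemma mp_class_RMP: "F \<in> carrier Lin \<Longrightarrow> mp_class F \<in> carrier RMP"
  by (auto simp: MP_ring_def FactRing_def A_RCOSETS_def' mp_class_def)

lemma ev_eq: "ev C = the_elem (lin_op ` C)"
  by (simp add: MP_op_def lin_op_def[abs_def])

lemma ev_mp_class: "F \<in> carrier Lin \<Longrightarrow> ev (mp_class F) = lin_op F"
  using ring_hom_ring.the_elem_simp[OF lin_op_hom, of F]
  by (simp add: lin_op_kernel mp_class_def ev_eq)

lemma ev_iso: "ev \<in> ring_iso RMP (R\<lparr>carrier := Gen\<rparr>)"
proof -
  have "lin_op \<in> ring_hom Lin (R\<lparr>carrier := Gen\<rparr>)"
    using ring_hom_ring.homh[OF lin_op_hom] lin_op_Gen by (auto simp: ring_hom_def)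
  then interpret lin_op': ring_hom_ring Lin "R\<lparr>carrier := Gen\<rparr>" lin_op
    by (intro ring_hom_ringI2 linearized_ring_ring ring.generate_ring_is_ring[OF R_ring gens_R])
  have zero_eq: "\<zero>\<^bsub>R\<lparr>carrier := Gen\<rparr>\<^esub> = \<zero>\<^bsub>R\<^esub>" by simp
  have "a_kernel Lin (R\<lparr>carrier := Gen\<rparr>) lin_op = MP_ideal r m n"
    unfolding lin_op_kernel[symmetric] a_kernel_def' zero_eq by (rule refl)
  then have "(\<lambda>C. the_elem (lin_op ` C)) \<in> ring_iso RMP (R\<lparr>carrier := Gen\<rparr>)"
    using lin_op'.FactRing_iso_set lin_op_image by (simp add: MP_ring_def)
  then show ?thesis by (simp only: ev_eq[abs_def, symmetric])
qed

lemma ev_hom: "ev \<in> ring_hom RMP R"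
proof -
  have "ev \<in> ring_hom RMP (R\<lparr>carrier := Gen\<rparr>)" using ev_iso by (simp add: ring_iso_def)
  then show ?thesis using Gen_R by (auto simp: ring_hom_def)
qed

lemma ev_inj: "inj_on ev (carrier RMP)" and ev_image: "ev ` carrier RMP = Gen"
  using ev_iso by (auto simp: ring_iso_def bij_betw_def)

lemma RMP_reduced:
  assumes "C \<in> carrier RMP"
  shows "\<exists>\<beta>. (\<forall>j. \<beta> j \<in> GF m) \<and> C = mp_class (reduced \<beta>)"
proof -
  obtain F where F: "F \<in> carrier Lin" "C = mp_class F"
    using assms by (auto simp: MP_ring_def FactRing_def A_RCOSETS_def' mp_class_def)
  obtain \<beta> where \<beta>: "\<forall>j. \<beta> j \<in> GF m" "F - reduced \<beta> \<in> MP_ideal r m n"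
    using reduction[OF F(1)] by blast
  have red: "reduced \<beta> \<in> carrier Lin" using \<beta> by (intro reduced_Lin) auto
  have "lin_op (F - reduced \<beta>) = \<zero>\<^bsub>R\<^esub>"
    using \<beta>(2) unfolding lin_op_kernel[symmetric] by (simp only: mem_a_kernel_iff)
  then have "poly F v = poly (reduced \<beta>) v" if "v \<in> V" for v
    using that by (auto simp: lin_op_def R_simps dest!: fun_cong[of _ _ v])
  then have "lin_op F = lin_op (reduced \<beta>)"
    unfolding lin_op_def by (rule restrict_ext)
  then have "mp_class F = mp_class (reduced \<beta>)"
    by (intro inj_onD[OF ev_inj]) (simp_all add: ev_mp_class mp_class_RMP F(1) red)
  then show ?thesis using F \<beta> by blast
qed

section \<open>The tensor decomposition\<close>

lemma scalar_op_hom: "scalar_op M \<in> ring_hom K R"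
proof (rule ring_hom_memI)
  fix x assume "x \<in> carrier K"
  then obtain a where a: "x = resid a" by (auto simp: carrier_K)
  show "scalar_op M x \<in> carrier R"
    unfolding a scalar_op_resid
    by (rule R_restrictI) (auto simp: \<Phi>_V \<Phi>_add_arg \<Phi>_frob intro: \<Phi>_commute)
  fix y assume "y \<in> carrier K"
  then obtain b where b: "y = resid b" by (auto simp: carrier_K)
  show "scalar_op M (x \<otimes>\<^bsub>K\<^esub> y) = scalar_op M x \<otimes>\<^bsub>R\<^esub> scalar_op M y"
    "scalar_op M (x \<oplus>\<^bsub>K\<^esub> y) = scalar_op M x \<oplus>\<^bsub>R\<^esub> scalar_op M y"
    by (auto simp: a b resid_simps scalar_op_resid R_simps compose_def \<Phi>_V \<Phi>_mult \<Phi>_add intro!: restrict_ext)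
qed (auto simp: resid_simps scalar_op_resid R_simps one_pCons \<Phi>_const intro!: restrict_ext)

lemma lin_op_reduced_comb:
  assumes "\<And>i j. \<beta> i j \<in> GF m"
  shows "(\<Oplus>\<^bsub>R\<^esub>i\<in>{..<r}. scalar_op M (resid (monom 1 i)) \<otimes>\<^bsub>R\<^esub> ev (mp_class (reduced (\<beta> i)))) =
    restrict (comb (\<lambda>(i, j). \<beta> i j)) V"
proof -
  interpret R: ring R by (rule R_ring)
  have red: "reduced (\<beta> i) \<in> carrier Lin" for i using assms by (rule reduced_Lin)
  have u: "scalar_op M (resid a) \<in> carrier R" for a
    using ring_hom_closed[OF scalar_op_hom] resid_simps(1) by blast
  have w: "lin_op (reduced (\<beta> i)) \<in> carrier R" for i
    using lin_op_Gen[OF red] Gen_R by blast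
  have "(\<Oplus>\<^bsub>R\<^esub>i\<in>{..<r}. scalar_op M (resid (monom 1 i)) \<otimes>\<^bsub>R\<^esub> ev (mp_class (reduced (\<beta> i)))) =
    (\<lambda>v\<in>V. \<Sum>i<r. (scalar_op M (resid (monom 1 i)) \<otimes>\<^bsub>R\<^esub> lin_op (reduced (\<beta> i))) v)"
    using u w by (simp add: ev_mp_class red R_finsum)
  also have "\<dots> = restrict (comb (\<lambda>(i, j). \<beta> i j)) V"
  proof (rule restrict_ext)
    fix v assume v: "v \<in> V"
    have "(scalar_op M (resid (monom 1 i)) \<otimes>\<^bsub>R\<^esub> lin_op (reduced (\<beta> i))) v =
        \<Phi> (monom 1 i) (poly (reduced (\<beta> i)) v)" for i
    proof -
      have "poly (reduced (\<beta> i)) v \<in> V"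
        using w[of i] v by (auto simp: R_iff E_iff lin_op_def PiE_iff)
      then show ?thesis using v by (simp add: scalar_op_resid R_simps compose_def lin_op_def)
    qed
    then show "(\<Sum>i<r. (scalar_op M (resid (monom 1 i)) \<otimes>\<^bsub>R\<^esub> lin_op (reduced (\<beta> i))) v) =
        comb (\<lambda>(i, j). \<beta> i j) v"
      using \<Phi>_poly_reduced[of \<beta> v] assms by simp
  qed
  finally show ?thesis .
qed

lemma residue_const_eq: "residue_const p c = resid [:c:]"
  by (simp add: residue_const_def resid_def)

lemma const_Lin: "[:0, to_ac c:] \<in> carrier Lin"
  using linearized_monom[of "to_ac c" m r 0] by (simp add: GF_to_ac monom_altdef)

lemma K_expansion: "\<exists>c. resid a = (\<Oplus>\<^bsub>K\<^esub>i\<in>{..<r}. resid (monom 1 i) \<otimes>\<^bsub>K\<^esub> residue_const p (c i))"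
proof -
  interpret resid: ring_hom_ring A_ring K resid by (rule resid_hom)
  let ?b = "a mod p"
  have sum: "(\<Oplus>\<^bsub>A_ring\<^esub>i\<in>I. f i) = (\<Sum>i\<in>I. f i)" if "finite I" for I and f :: "nat \<Rightarrow> 'f poly"
    using that by (induction I rule: finite_induct) (simp_all add: resid.R.finsum_insert)
  have "?b = (\<Sum>i\<le>degree ?b. monom (coeff ?b i) i)" by (simp add: poly_as_sum_of_monoms)
  also have "\<dots> = (\<Sum>i<r. monom (coeff ?b i) i)"
    using degree_mod_p[of a] by (intro sum.mono_neutral_left) (auto simp: coeff_eq_0)
  also have "\<dots> = (\<Sum>i<r. monom 1 i * [:coeff ?b i:])"
    by (simp add: mult.commute[of "monom 1 _"] smult_monom)
  finally have "resid a = resid (\<Oplus>\<^bsub>A_ring\<^esub>i\<in>{..<r}. monom 1 i * [:coeff ?b i:])"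
    using resid_mod[of a] by (simp add: sum)
  also have "\<dots> = (\<Oplus>\<^bsub>K\<^esub>i\<in>{..<r}. resid (monom 1 i) \<otimes>\<^bsub>K\<^esub> residue_const p (coeff ?b i))"
    by (subst resid.hom_finsum) (auto simp: o_def residue_const_eq resid_simps)
  finally show ?thesis by blast
qed

lemma tensor_iso:
  "\<exists>\<mu>\<in>ring_iso (tensor_ring (residue_const p) (MP_const r m n) K RMP) R.
     \<forall>a\<in>carrier K. \<forall>F\<in>carrier RMP.
       \<mu> (pure_tensor (residue_const p) (MP_const r m n) K RMP a F) = scalar_op M a \<otimes>\<^bsub>R\<^esub> ev F"
proof (rule tensor_ring_iso_of_basis[where I = "{..<r}" and e = "\<lambda>i. resid (monom 1 i)"])
  show "ring K" using K_cring by (rule cring.axioms)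
  show "ring RMP" "ring R" by (rule RMP_ring R_ring)+
  show "scalar_op M \<in> ring_hom K R" "ev \<in> ring_hom RMP R" by (rule scalar_op_hom ev_hom)+
  show "scalar_op M a \<otimes>\<^bsub>R\<^esub> ev F = ev F \<otimes>\<^bsub>R\<^esub> scalar_op M a" if "a \<in> carrier K" "F \<in> carrier RMP" for a F
  proof -
    have "ev F \<in> carrier R" using ring_hom_closed[OF ev_hom that(2)] .
    then show ?thesis using that(1)
      by (auto simp: carrier_K scalar_op_resid R_simps R_iff E_iff compose_def \<Phi>_V PiE_iff intro!: restrict_ext)
  qed
  show "residue_const p c \<in> carrier K" for c by (simp add: residue_const_eq resid_simps)
  have MP_const: "MP_const r m n c = mp_class [:0, to_ac c:]" for c by (simp add: MP_const_def mp_class_def)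
  show "MP_const r m n c \<in> carrier RMP" for c by (simp add: MP_const mp_class_RMP const_Lin)
  show "scalar_op M (residue_const p c) = ev (MP_const r m n c)" for c
    unfolding MP_const ev_mp_class[OF const_Lin] residue_const_eq scalar_op_resid lin_op_def
    by (rule restrict_ext) (simp add: \<Phi>_const)
  show "finite {..<r}" by simp
  show "resid (monom 1 i) \<in> carrier K" for i by (rule resid_simps)
  show "\<exists>c. a = (\<Oplus>\<^bsub>K\<^esub>i\<in>{..<r}. resid (monom 1 i) \<otimes>\<^bsub>K\<^esub> residue_const p (c i))" if "a \<in> carrier K" for a
    using that K_expansion by (auto simp: carrier_K)
  show "\<exists>b\<in>{..<r} \<rightarrow> carrier RMP. f = (\<Oplus>\<^bsub>R\<^esub>i\<in>{..<r}. scalar_op M (resid (monom 1 i)) \<otimes>\<^bsub>R\<^esub> ev (b i))"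
    if f: "f \<in> carrier R" for f
  proof -
    obtain c where c: "\<forall>x. c x \<in> GF m" "f = restrict (comb c) V" using R_eq_comb[OF f] by blast
    have "f = (\<Oplus>\<^bsub>R\<^esub>i\<in>{..<r}. scalar_op M (resid (monom 1 i)) \<otimes>\<^bsub>R\<^esub> ev (mp_class (reduced (\<lambda>j. c (i, j)))))"
      using lin_op_reduced_comb[of "\<lambda>i j. c (i, j)"] c by simp
    then show ?thesis using c(1)
      by (intro bexI[of _ "\<lambda>i. mp_class (reduced (\<lambda>j. c (i, j)))"]) (auto intro: mp_class_RMP reduced_Lin)
  qed
  fix b i assume b: "b \<in> {..<r} \<rightarrow> carrier RMP" and i: "i \<in> {..<r}"
    and zero: "(\<Oplus>\<^bsub>R\<^esub>i\<in>{..<r}. scalar_op M (resid (monom 1 i)) \<otimes>\<^bsub>R\<^esub> ev (b i)) = \<zero>\<^bsub>R\<^esub>"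
  interpret R: ring R by (rule R_ring)
  have "\<exists>\<beta>. (\<forall>j. \<beta> j \<in> GF m) \<and> (i < r \<longrightarrow> b i = mp_class (reduced \<beta>))" for i
    using b RMP_reduced[of "b i"] by (cases "i < r") (auto intro: exI[of _ "\<lambda>j. 0"])
  then obtain \<beta> where \<beta>: "\<forall>i. (\<forall>j. \<beta> i j \<in> GF m) \<and> (i < r \<longrightarrow> b i = mp_class (reduced (\<beta> i)))"
    by metis
  have "scalar_op M (resid a) \<in> carrier R" for a
    using ring_hom_closed[OF scalar_op_hom] resid_simps(1) by blast
  then have "(\<Oplus>\<^bsub>R\<^esub>i\<in>{..<r}. scalar_op M (resid (monom 1 i)) \<otimes>\<^bsub>R\<^esub> ev (b i)) =
      (\<Oplus>\<^bsub>R\<^esub>i\<in>{..<r}. scalar_op M (resid (monom 1 i)) \<otimes>\<^bsub>R\<^esub> ev (mp_class (reduced (\<beta> i))))"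
    using \<beta> by (intro R.finsum_cong')
      (auto intro!: R.m_closed ring_hom_closed[OF ev_hom] mp_class_RMP reduced_Lin)
  then have "restrict (comb (\<lambda>(i, j). \<beta> i j)) V = \<zero>\<^bsub>R\<^esub>"
    using zero lin_op_reduced_comb[of \<beta>] \<beta> by simp
  then have "comb (\<lambda>(i, j). \<beta> i j) v = 0" if "v \<in> V" for v
    using that by (auto simp: R_simps dest!: fun_cong[of _ _ v])
  then have "j < n \<Longrightarrow> \<beta> i j = 0" for j
    using comb_eq_0[of "\<lambda>(i, j). \<beta> i j" i j] \<beta> i by auto
  then have "b i = mp_class 0" using \<beta> i by (simp add: reduced_def)
  moreover interpret mp_class: ring_hom_ring Lin RMP mp_class
    using ideal.rcos_ring_hom_ring[OF MP_ideal_ideal] unfolding MP_ring_def mp_class_def[abs_def] .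
  have "mp_class 0 = \<zero>\<^bsub>RMP\<^esub>" using mp_class.hom_zero by (simp add: linearized_ring_simps)
  ultimately show "b i = \<zero>\<^bsub>RMP\<^esub>" by simp
qed

section \<open>The case of degree one\<close>

text \<open>
  The operators of \<open>R\<^bsub>MP\<^esub>\<close> are those whose coordinates vanish outside the row \<open>i = 0\<close>. For \<open>r = 1\<close> this
  is the only row; for \<open>r > 1\<close> the operator \<open>T\<close> itself has coordinate \<open>1\<close> at \<open>(1, 0)\<close>.
\<close>

lemma Gen_eq_R_iff: "Gen = carrier R \<longleftrightarrow> r = 1"
proof
  assume r: "r = 1"
  have "f \<in> Gen" if f: "f \<in> carrier R" for f
  proof -
    obtain c where c: "\<forall>x. c x \<in> GF m" "f = restrict (comb c) V" using R_eq_comb[OF f] by blast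
    have "comb c v = poly (reduced (\<lambda>j. c (0, j))) v" for v
    proof -
      have "{..<r} = {0}" using r by auto
      then show ?thesis using \<Phi>_poly_reduced[of "\<lambda>i j. c (i, j)" v] c(1) \<Phi>_monom[of 0]
        by simp
    qed
    then have "f = lin_op (reduced (\<lambda>j. c (0, j)))"
      unfolding c(2) lin_op_def by (intro restrict_ext)
    then show ?thesis using c(1) lin_op_Gen reduced_Lin by simp
  qed
  then show "Gen = carrier R" using Gen_R by blast
next
  assume eq: "Gen = carrier R"
  show "r = 1"
  proof (rule ccontr)
    assume "r \<noteq> 1"
    then have r: "1 < r" using r_pos by simp
    define c where "c = (\<lambda>x. if x = (1::nat, 0::nat) then 1 else 0 :: 'f alg_closure)"
    have c: "c x \<in> GF m" for x by (simp add: c_def)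
    have "restrict (comb c) V \<in> ev ` carrier RMP"
      unfolding ev_image eq by (rule comb_R[OF c])
    then obtain \<beta> where \<beta>: "\<forall>j. \<beta> j \<in> GF m" "restrict (comb c) V = ev (mp_class (reduced \<beta>))"
      using RMP_reduced by auto
    define \<gamma> where "\<gamma> = (\<lambda>i::nat. if i = 0 then \<beta> else (\<lambda>j. 0))"
    have \<gamma>: "\<gamma> i j \<in> GF m" for i j using \<beta> by (simp add: \<gamma>_def)
    have "comb c v = comb (\<lambda>(i, j). \<gamma> i j) v" if v: "v \<in> V" for v
    proof -
      have "restrict (comb c) V v = lin_op (reduced \<beta>) v"
        unfolding \<beta>(2) using \<beta>(1) by (simp add: ev_mp_class reduced_Lin)
      then have "comb c v = poly (reduced \<beta>) v" using v by (simp add: lin_op_def)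
      also have "\<dots> = (\<Sum>i<r. if i = 0 then poly (reduced \<beta>) v else 0)" using r by simp
      also have "\<dots> = (\<Sum>i<r. \<Phi> (monom 1 i) (poly (reduced (\<gamma> i)) v))"
        by (intro sum.cong) (auto simp: \<gamma>_def \<Phi>_monom poly_reduced)
      finally show ?thesis using \<Phi>_poly_reduced[of \<gamma> v] \<gamma> by simp
    qed
    moreover have "c x \<in> V" "(case x of (i, j) \<Rightarrow> \<gamma> i j) \<in> V" for x
      using subsetD[OF GF_sub_V(4) c] subsetD[OF GF_sub_V(4) \<gamma>] by (simp_all split: prod.split)
    moreover have "(1, 0) \<in> idx" using r n_pos by (simp add: idx_def)
    ultimately have "c (1, 0) = (\<lambda>(i, j). \<gamma> i j) (1, 0)"
      using comb_inj[of c "\<lambda>(i, j). \<gamma> i j" "(1, 0)"] by blast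
    then show False by (simp add: c_def \<gamma>_def)
  qed
qed

text \<open>
  For \<open>r = 1\<close> the polynomial \<open>p\<close> has degree one, so that every class in \<open>\<kappa>\<close> is that of a
  unique constant.
\<close>

lemma S_normal_iff:
  assumes r: "r = 1"
  shows "S_normal K M r n \<alpha> \<longleftrightarrow>
    basis_family (ring_of_type_algebra :: 'f ring) (GF_module n) n (\<lambda>i. frob i \<alpha>)"
proof -
  let ?F = "ring_of_type_algebra :: 'f ring"
  have "basis_family ?F (GF_module n) n (\<lambda>i. frob i \<alpha>) \<longleftrightarrow> basis_family K M n (\<lambda>i. frob i \<alpha>)"
  proof (rule basis_family_transport[where \<psi> = "residue_const p"])
    show "abelian_group M" using M_module by (simp add: module_def)
    show "abelian_group (GF_module n)"
      by (rule abelian_groupI)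
        (auto simp: GF_module_def GF_add add_ac intro!: bexI[of _ "- x" for x] GF_uminus)
    show "carrier (GF_module n) = carrier M" "\<zero>\<^bsub>GF_module n\<^esub> = \<zero>\<^bsub>M\<^esub>"
      by (simp_all add: GF_module_def r)
    show "add (GF_module n) = add M" by (simp add: GF_module_def torsion_module_def)
    have "inj (residue_const p)"
    proof (rule injI)
      fix c d assume "residue_const p c = residue_const p d"
      then have "p dvd [:c - d:]" by (simp add: residue_const_eq resid_eq_iff)
      then show "c = d" using p_deg r dvd_imp_degree_le[of p "[:c - d:]"] by (cases "c = d") auto
    qed
    moreover have "range (residue_const p) = carrier K"
    proof -
      have "resid a \<in> range (residue_const p)" for a
      proof -
        have "degree (a mod p) = 0" using degree_mod_p[of a] r by simp
        then obtain c where "a mod p = [:c:]" by (rule degree_eq_zeroE)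
        then show ?thesis using resid_mod[of a] by (auto simp: residue_const_eq)
      qed
      then show ?thesis by (auto simp: carrier_K residue_const_eq)
    qed
    ultimately show "bij_betw (residue_const p) (carrier ?F) (carrier K)"
      by (simp add: bij_betw_def ring_of_type_algebra_def)
    show "residue_const p \<zero>\<^bsub>?F\<^esub> = \<zero>\<^bsub>K\<^esub>" "\<zero>\<^bsub>?F\<^esub> \<in> carrier ?F"
      by (simp_all add: ring_of_type_algebra_def residue_const_eq resid_simps)
    show "c \<odot>\<^bsub>GF_module n\<^esub> v = residue_const p c \<odot>\<^bsub>M\<^esub> v" if "v \<in> carrier M" for c v
      using that by (simp add: GF_module_def residue_const_eq smult_resid \<Phi>_const)
    show "c \<odot>\<^bsub>M\<^esub> v \<in> carrier M" if "c \<in> carrier K" "v \<in> carrier M" for c v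
      using that by (auto simp: carrier_K smult_resid \<Phi>_V)
  qed
  then show ?thesis by (simp add: S_normal_def r)
qed

end

theorem lemma7p1:
  fixes p0 p :: "'f::{field,finite} poly"
    and t :: "'f alg_closure"
    and n m r :: nat
    and \<phi> :: "'f poly \<Rightarrow> 'f alg_closure poly"
    and \<kappa> :: "'f poly set ring"
    and M :: "('f poly set, 'f alg_closure) module"
    and R :: "('f alg_closure \<Rightarrow> 'f alg_closure) ring"
    and L :: "('f alg_closure \<Rightarrow> 'f alg_closure) set"
    and \<pi> :: "'f alg_closure \<Rightarrow> 'f alg_closure"
    and RMP :: "'f alg_closure poly set ring"
    and ev :: "'f alg_closure poly set \<Rightarrow> 'f alg_closure \<Rightarrow> 'f alg_closure"
  assumes n: "n \<ge> 1"
    and p0: "lead_coeff p0 = 1" "irreducible p0" "degree p0 = r"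
    and coprime: "coprime n r"
    and t: "t \<in> GF r" "poly (map_poly to_ac p0) t = 0"
    and \<phi>: "twisted_algebra_hom r \<phi>" "\<phi> [:0, 1:] = [:t:] + monom 1 n"
    and m: "m dvd n"
    and p: "p = p0 - 1" "irreducible p"
    and \<kappa>: "\<kappa> = residue_field p"
    and M: "M = torsion_module \<phi> p"
    and R: "R = skew_code_ring \<kappa> M r m"
    and L: "L = field_scalar_ops (carrier M) m"
    and \<pi>: "\<pi> = frob_op (carrier M) r"
    and RMP: "RMP = MP_ring r m n"
    and ev: "ev = MP_op (carrier M)"
  shows "carrier M = GF (n * r) \<and>
    L \<union> {\<pi>} \<subseteq> carrier R \<and>
    ev \<in> ring_iso RMP (R\<lparr>carrier := generate_ring R (L \<union> {\<pi>})\<rparr>) \<and>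
    (\<exists>\<mu> \<in> ring_iso (tensor_ring (residue_const p) (MP_const r m n) \<kappa> RMP) R.
       \<forall>a\<in>carrier \<kappa>. \<forall>F\<in>carrier RMP.
         \<mu> (pure_tensor (residue_const p) (MP_const r m n) \<kappa> RMP a F)
           = scalar_op M a \<otimes>\<^bsub>R\<^esub> ev F) \<and>
    (ev ` carrier RMP = carrier R \<longleftrightarrow> r = 1) \<and>
    (r = 1 \<longrightarrow>
       {I. left_ideal I R} = (\<lambda>J. ev ` J) ` {J. left_ideal J RMP} \<and>
       (\<forall>\<alpha>\<in>carrier M. S_normal \<kappa> M r n \<alpha> \<longleftrightarrow>
          basis_family (ring_of_type_algebra :: 'f ring) (GF_module n) n (\<lambda>i. frob i \<alpha>)))"
proof -
  have "degree p0 \<noteq> 0" using p0(2) by (metis irreducible_def is_unit_iff_degree)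
  then interpret D: drinfeld_torsion t n m r p0 p \<phi>
    using n p0 coprime t \<phi> m p(1) by unfold_locales auto
  have V: "carrier M = GF (n * r)" by (simp add: M)
  have "{I. left_ideal I R} = (\<lambda>J. ev ` J) ` {J. left_ideal J RMP}" if "r = 1"
  proof -
    have "R\<lparr>carrier := generate_ring R (L \<union> {\<pi>})\<rparr> = R"
      using D.Gen_eq_R_iff that unfolding R \<kappa> M L \<pi> by simp
    then have "ev \<in> ring_iso RMP R"
      using D.ev_iso unfolding R \<kappa> M L \<pi> RMP ev by simp
    then show ?thesis using D.RMP_ring D.R_ring by (intro left_ideals_iso) (simp_all add: R \<kappa> M RMP)
  qed
  then show ?thesis
    using V D.gens_R D.ev_iso D.tensor_iso D.Gen_eq_R_iff D.ev_image D.S_normal_iff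
    unfolding R \<kappa> M L \<pi> RMP ev by simp
qed

end
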